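(* For every $D\in\mathbb{N}$ there exists a constant $C=C(D)$, depending only on $D$, such that for every connected infinite penny graph $G=(V,E,F)$ with $\sup_{\sigma\in F}\deg(\sigma)=D$, one has $$\dim \mathcal{H}^k(G)\leq Ck,\quad \forall k\geq 1.$$
   Context: Penny graphs. Let $\{C_i\}_{i=1}^\infty$ be an infinite collection of circles of radius $\frac12$ in $\mathbb{R}^2$ bounding open disks $\{D_i\}_{i=1}^\infty$ that are pairwise disjoint. The penny graph of this configuration is the graph $(V,E)$ with one vertex $v_i$ for each circle $C_i$, and $\{v_i,v_j\}\in E$ if and only if $C_i$ and $C_j$ are tangent. Placing $v_i$ at the center of $C_i$ and each edge as the straight segment joining the two centers embeds $(V,E)$ in $\mathbb{R}^2$; vertices and edges are identified with their images. The set $F$ of faces consists of the connected components of the complement in $\mathbb{R}^2$ of the embedded graph, and $G=(V,E,F)$ is called an infinite penny graph. It is connected if $(V,E)$ is connected. For $\sigma\in F$, the facial degree $\deg(\sigma)\in\mathbb{N}\cup\{\infty\}$ is the number of interior angles (corners) of the polygonal domain $\sigma$ (counted with multiplicity, i.e. along the boundary walk, which may have self-intersections). Harmonic functions. The combinatorial Laplacian is $\Delta f(x)=\sum_{y\sim x}(f(y)-f(x))$ for $f:V\to\mathbb{R}$, the sum being over neighbours $y$ of $x$. A function $f$ is harmonic if $\Delta f\equiv 0$. Let $d$ be the combinatorial graph distance and fix $x_0\in V$. For real $k\ge 0$, $$\mathcal{H}^k(G)=\{u:V\to\mathbb{R}:\ \Delta u\equiv 0,\ \exists C\ \ |u(x)|\leq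 C(1+d(x,x_0))^k\ \ \forall x\in V\}$$ (a real vector space, independent of $x_0$). *)

theory Defs
  imports "HOL-Analysis.Analysis" "HOL-Library.Function_Algebras" "HOL-Library.Extended_Nat"
begin

text \<open>
  An infinite family of circles of radius \<open>1/2\<close> is given by its sequence of centres
  \<open>c :: nat \<Rightarrow> real ^ 2\<close>.  The vertex belonging to the \<open>i\<close>-th circle is the index \<open>i\<close>; it is
  placed in the plane at \<open>c i\<close>.
\<close>

definition disk :: "(nat \<Rightarrow> real ^ 2) \<Rightarrow> nat \<Rightarrow> (real ^ 2) set" where
  "disk c i = ball (c i) (1 / 2)"

definition circle :: "(nat \<Rightarrow> real ^ 2) \<Rightarrow> nat \<Rightarrow> (real ^ 2) set" where
  "circle c i = sphere (c i) (1 / 2)"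

definition penny_configuration :: "(nat \<Rightarrow> real ^ 2) \<Rightarrow> bool" where
  "penny_configuration c \<longleftrightarrow> (\<forall>i j. i \<noteq> j \<longrightarrow> disk c i \<inter> disk c j = {})"

text \<open>
  Two circles of equal radius are tangent iff they have exactly one common point.
  No circle is adjacent to itself, as a circle has more than one point.
\<close>

definition adjacent :: "(nat \<Rightarrow> real ^ 2) \<Rightarrow> nat \<Rightarrow> nat \<Rightarrow> bool" where
  "adjacent c i j \<longleftrightarrow> (\<exists>!p. p \<in> circle c i \<inter> circle c j)"

definition graph_connected :: "(nat \<Rightarrow> real ^ 2) \<Rightarrow> bool" where
  "graph_connected c \<longleftrightarrow> (\<forall>i j. (adjacent c)\<^sup>*\<^sup>* i j)"

text \<open>The length of a shortest walk; only meaningful if \<open>i\<close> and \<open>j\<close> are joined by a walk.\<close>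

definition graph_dist :: "(nat \<Rightarrow> real ^ 2) \<Rightarrow> nat \<Rightarrow> nat \<Rightarrow> nat" where
  "graph_dist c i j = (LEAST n. (adjacent c ^^ n) i j)"

definition embedded_graph :: "(nat \<Rightarrow> real ^ 2) \<Rightarrow> (real ^ 2) set" where
  "embedded_graph c = range c \<union> \<Union>{closed_segment (c i) (c j) | i j. adjacent c i j}"

definition faces :: "(nat \<Rightarrow> real ^ 2) \<Rightarrow> (real ^ 2) set set" where
  "faces c = components (- embedded_graph c)"

text \<open>
  In a penny configuration an edge meets the open disk \<open>disk c i\<close> only if it is incident to
  \<open>i\<close>, and then in a radius.  So if \<open>i\<close> is not isolated, the components of \<open>disk c i\<close> minus the
  graph are the open circular sectors between cyclically consecutive edges at \<open>i\<close>, i.e. the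
  angles at \<open>i\<close> (a slit disk, an angle of \<open>2 \<pi>\<close>, if \<open>i\<close> has a single neighbour).  Each
  of them lies in exactly one face.  A vertex that is visited several times by the boundary
  walk of \<open>\<sigma>\<close> contributes one sector for each visit, so that the corners of \<open>\<sigma>\<close> below are
  counted with multiplicity.
\<close>

definition corners :: "(nat \<Rightarrow> real ^ 2) \<Rightarrow> (real ^ 2) set \<Rightarrow> (nat \<times> (real ^ 2) set) set" where
  "corners c \<sigma> = {(i, S). S \<in> components (disk c i - embedded_graph c) \<and> S \<subseteq> \<sigma>}"

definition facial_degree :: "(nat \<Rightarrow> real ^ 2) \<Rightarrow> (real ^ 2) set \<Rightarrow> enat" where
  "facial_degree c \<sigma> = (if finite (corners c \<sigma>) then enat (card (corners c \<sigma>)) else \<infinity>)"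

definition laplacian :: "(nat \<Rightarrow> real ^ 2) \<Rightarrow> (nat \<Rightarrow> real) \<Rightarrow> nat \<Rightarrow> real" where
  "laplacian c u x = (\<Sum>y | adjacent c x y. u y - u x)"

text \<open>The sum above is a genuine one, since penny graphs are locally finite.\<close>

lemma finite_neighbours:
  assumes "penny_configuration c"
  shows "finite {j. adjacent c i j}"
proof (rule ccontr)
  assume inf: "infinite {j. adjacent c i j}"
  have "inj c"
  proof (rule injI, rule ccontr)
    fix a b assume "c a = c b" "a \<noteq> b"
    then have "ball (c a) (1 / 2) = {}"
      using assms unfolding penny_configuration_def disk_def by (metis inf.idem)
    then show False by simp
  qed
  let ?S = "c ` {j. adjacent c i j}"
  have "infinite ?S"
    using inf \<open>inj c\<close> by (meson finite_imageD inj_on_subset subset_UNIV)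
  moreover have "?S \<subseteq> cball (c i) 1"
  proof clarsimp
    fix j assume "adjacent c i j"
    then obtain p where "dist (c i) p = 1 / 2" "dist (c j) p = 1 / 2"
      unfolding adjacent_def circle_def by auto
    then show "dist (c i) (c j) \<le> 1"
      using dist_triangle2[of "c i" "c j" p] by simp
  qed
  ultimately obtain l where "l islimpt ?S"
    using compact_cball[of "c i" 1] unfolding compact_eq_Bolzano_Weierstrass by blast
  then have "infinite (?S \<inter> ball l (1 / 2))"
    unfolding islimpt_eq_infinite_ball by simp
  then obtain p q where "p \<in> ?S \<inter> ball l (1 / 2)" "q \<in> ?S \<inter> ball l (1 / 2)" "p \<noteq> q"
    by (metis finite.simps finite_subset singleton_iff subsetI)
  then obtain a b where "a \<noteq> b" "l \<in> ball (c a) (1 / 2)" "l \<in> ball (c b) (1 / 2)"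
    by (metis (no_types, lifting) IntE dist_commute imageE mem_ball)
  then show False
    using assms unfolding penny_configuration_def disk_def by blast
qed

definition polynomial_growth_harmonic :: "(nat \<Rightarrow> real ^ 2) \<Rightarrow> nat \<Rightarrow> real \<Rightarrow> (nat \<Rightarrow> real) set" where
  "polynomial_growth_harmonic c x0 k =
     {u. (\<forall>x. laplacian c u x = 0) \<and>
         (\<exists>C. \<forall>x. \<bar>u x\<bar> \<le> C * (1 + real (graph_dist c x x0)) powr k)}"

global_interpretation real_fun: vector_space "\<lambda>(a :: real) (u :: nat \<Rightarrow> real) x. a * u x"
  defines real_fun_span = real_fun.span
    and real_fun_dim = real_fun.dim
    and real_fun_subspace = real_fun.subspace
  by unfold_locales (auto simp: fun_eq_iff algebra_simps)

lemma subspace_polynomial_growth_harmonic: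
  "real_fun_subspace (polynomial_growth_harmonic c x0 k)"
proof (rule real_fun.subspaceI)
  show "0 \<in> polynomial_growth_harmonic c x0 k"
    by (auto simp: polynomial_growth_harmonic_def laplacian_def intro: exI[of _ 0])
next
  fix u v
  assume u: "u \<in> polynomial_growth_harmonic c x0 k" and v: "v \<in> polynomial_growth_harmonic c x0 k"
  have "laplacian c (u + v) x = laplacian c u x + laplacian c v x" for x
    by (simp add: laplacian_def flip: sum.distrib) (simp add: algebra_simps)
  moreover obtain A B where
    A: "\<And>x. \<bar>u x\<bar> \<le> A * (1 + real (graph_dist c x x0)) powr k" and
    B: "\<And>x. \<bar>v x\<bar> \<le> B * (1 + real (graph_dist c x x0)) powr k"
    using u v by (auto simp: polynomial_growth_harmonic_def)
  have "\<bar>(u + v) x\<bar> \<le> (A + B) * (1 + real (graph_dist c x x0)) powr k" for x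
    using A[of x] B[of x] by (simp add: distrib_right)
  ultimately show "u + v \<in> polynomial_growth_harmonic c x0 k"
    using u v unfolding polynomial_growth_harmonic_def by auto
next
  fix a u
  assume u: "u \<in> polynomial_growth_harmonic c x0 k"
  have "laplacian c (\<lambda>x. a * u x) x = a * laplacian c u x" for x
    by (simp add: laplacian_def sum_distrib_left right_diff_distrib)
  moreover obtain A where A: "\<And>x. \<bar>u x\<bar> \<le> A * (1 + real (graph_dist c x x0)) powr k"
    using u by (auto simp: polynomial_growth_harmonic_def)
  have "\<bar>a * u x\<bar> \<le> (\<bar>a\<bar> * A) * (1 + real (graph_dist c x x0)) powr k" for x
    using mult_left_mono[OF A[of x], of "\<bar>a\<bar>"] by (simp add: abs_mult mult.assoc)
  ultimately show "(\<lambda>x. a * u x) \<in> polynomial_growth_harmonic c x0 k"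
    using u unfolding polynomial_growth_harmonic_def by auto
qed

text \<open>
  The library's \<open>dim\<close> is \<open>0\<close> on infinite-dimensional spaces, so finite-dimensionality has to be
  required separately.
\<close>

definition finite_dimensional :: "(nat \<Rightarrow> real) set \<Rightarrow> bool" where
  "finite_dimensional W \<longleftrightarrow> (\<exists>B. finite B \<and> W \<subseteq> real_fun_span B)"

end

theory Submission
  imports Defs
begin

text \<open>
  The argument is Li's dimension estimate for harmonic functions of polynomial growth, run on the
  graph with Euclidean balls.  Write \<open>B(R)\<close> for the set of vertices placed within distance \<open>R\<close> of
  a fixed centre and \<open>A(R)\<close> for the bilinear form \<open>\<Sum>i\<in>B(R). u i * v i\<close>.  Two facts about an
  \<open>m\<close>-dimensional space of harmonic functions of growth \<open>k\<close> pull in opposite directions, where the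
  radii \<open>R\<close> and \<open>R' = (1 + 1/k) * R\<close> are compared.

  Growth: in every direction \<open>A(R)\<close> grows at most like \<open>R\<close> to the power \<open>4 * k + 2\<close>.  The factor gained
  in passing from \<open>R\<close> to \<open>R'\<close> is therefore, on average over the scales, at most \<open>(1 + 1/k)\<close> to that
  power, which is at most \<open>exp 6\<close>.  Hence at some scales the trace of \<open>A(R)\<close> relative to \<open>A(R')\<close>
  is nearly as large as \<open>exp (-6) * m\<close> (\<open>dimension_bound_from_traces\<close>).  Graph distances are
  bounded only by squares of Euclidean ones (\<open>graph_dist_le_square\<close>), which doubles the exponent and
  so affects the constant alone.

  Mean value inequality: for harmonic \<open>u\<close>, the square of \<open>u x\<close> is at most a constant times \<open>1 / \<rho>\<^sup>2\<close>
  times the sum of the squares of \<open>u\<close> over the ball of radius \<open>\<rho>\<close> about \<open>x\<close>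
  (\<open>mean_value_inequality\<close>).  Applied to one suitable combination of an orthonormal basis, it bounds
  the sum of the squares of the basis functions at \<open>x\<close> by a constant over the squared distance from
  \<open>x\<close> to the boundary of the larger ball.  A shell of width 1 contains \<open>O(R)\<close> vertices, because
  the disks are disjoint, and the two radii differ by \<open>R / k\<close>; summing over \<open>B(R)\<close>, the trace is
  \<open>O(R / (R / k)) = O(k)\<close> (\<open>trace_le\<close>).  Together the two facts give \<open>m = O(k)\<close>.

  The mean value inequality has an elementary proof because the graph is planar.  By the maximum
  principle each circle about \<open>x\<close> comes close to a vertex where \<open>u\<close> is, in absolute value, at least as
  large as at \<open>x\<close>.  If the vertices near the circle form a connected chain, the oscillation of \<open>u\<close> on
  it is at most the sum of the differences along its edges, and the Cauchy-Schwarz inequality bounds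
  \<open>u x\<close> by sums of squares of \<open>u\<close> and of its differences over the chain (\<open>circle_estimate\<close>).  Adding up
  over disjoint circles of comparable radii leaves the Dirichlet energy of \<open>u\<close> on a ball, which
  Caccioppoli's inequality (\<open>caccioppoli\<close>) bounds by the sum of the squares of \<open>u\<close> on a larger one.

  The facial degree enters only through the geometry of such chains.  Every point of the boundary of a
  face is within distance 1 of a vertex at which the face has a corner, so that at most \<open>D\<close> disks of
  radius 1 cover the boundary, and some circle of bounded radius about a boundary point avoids it.
  Since the graph is connected and unbounded, the face lies inside this circle (\<open>face_subset_ball\<close>).
  Moreover the boundary of a face is connected, being the frontier of a component of the complement
  of a connected set.  Hence the vertices that are close to a connected set of points span a
  connected subgraph (\<open>cut_connected_nearby\<close>); circles and segments are the cases that are needed.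
\<close>

section \<open>Packing of disks and unit segments\<close>

lemma dist_ge_1:
  assumes "penny_configuration c" "i \<noteq> j"
  shows "dist (c i) (c j) \<ge> 1"
proof (rule ccontr)
  assume "\<not> ?thesis"
  then have "midpoint (c i) (c j) \<in> disk c i \<inter> disk c j"
    by (simp add: disk_def dist_midpoint)
  then show False
    using assms unfolding penny_configuration_def by blast
qed

lemma adjacent_sym: "adjacent c i j \<longleftrightarrow> adjacent c j i"
  unfolding adjacent_def by (simp add: Int_commute)

lemma adjacent_dist:
  assumes "penny_configuration c" "adjacent c i j"
  shows "dist (c i) (c j) = 1"
proof -
  from assms(2) obtain p where p: "dist (c i) p = 1/2" "dist (c j) p = 1/2"
    and uniq: "\<And>q. q \<in> circle c i \<inter> circle c j \<Longrightarrow> q = p"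
    unfolding adjacent_def circle_def by auto
  have "i \<noteq> j"
  proof
    assume "i = j"
    define q where "q = 2 *\<^sub>R c i - p"
    have "dist (c i) q = dist (c i) p"
      by (simp add: q_def dist_norm scaleR_2 norm_minus_commute)
    then have "q = p"
      using uniq[of q] p \<open>i = j\<close> by (simp add: circle_def)
    then have "2 *\<^sub>R (c i - p) = 0"
      by (simp add: q_def algebra_simps scaleR_2)
    then show False using p by simp
  qed
  moreover have "dist (c i) (c j) \<le> 1"
    using dist_triangle2[of "c i" "c j" p] p by simp
  ultimately show ?thesis
    using dist_ge_1[OF assms(1)] by fastforce
qed

text \<open>
  The disks about the vertices in an annulus are disjoint and lie in the annulus widened by \<open>1/2\<close> on
  both sides; compare areas.
\<close>

lemma packing_finite_subset:
  assumes "penny_configuration c" "finite I" "0 \<le> a" "a \<le> b"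
    and I: "\<And>i. i \<in> I \<Longrightarrow> a \<le> dist (c i) p \<and> dist (c i) p \<le> b"
  shows "real (card I) \<le> 4 * (b - a + 1) * (a + b + 1)"
proof -
  define V where "V = unit_ball_vol (real DIM(real^2))"
  have V: "V > 0" by (simp add: V_def)
  have vol: "measure lebesgue (ball q r) = V * r^2" if "r \<ge> 0" for q :: "real^2" and r
    using content_ball[of r q] that by (simp add: V_def)
  have vol_disk: "measure lebesgue (disk c i) = V / 4" for i
    using vol[of "1/2" "c i"] by (simp only: disk_def) (simp add: power2_eq_square)
  define a' where "a' = max 0 (a - 1/2)"
  have disj: "disjoint_family_on (\<lambda>i. disk c i) I"
    using assms(1) unfolding penny_configuration_def disjoint_family_on_def by blast
  have sub: "(\<Union>i\<in>I. disk c i) \<subseteq> ball p (b + 1/2) - ball p a'"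
  proof
    fix y assume "y \<in> (\<Union>i\<in>I. disk c i)"
    then obtain i where i: "i \<in> I" "dist (c i) y < 1/2" by (auto simp: disk_def)
    have "dist p y \<le> dist (c i) p + dist (c i) y" "dist (c i) p \<le> dist p y + dist (c i) y"
      by metric+
    then show "y \<in> ball p (b + 1/2) - ball p a'"
      using I[OF i(1)] i(2) zero_le_dist[of p y] by (simp add: a'_def max_def not_less)
  qed
  have "real (card I) * (V / 4) = (\<Sum>i\<in>I. measure lebesgue (disk c i))"
    by (simp add: vol_disk)
  also have "\<dots> = measure lebesgue (\<Union>i\<in>I. disk c i)"
    using disj assms(2) by (intro measure_UNION'[symmetric]) (auto simp: disk_def pairwise_def disjoint_family_on_def disjnt_def)
  also have "\<dots> \<le> measure lebesgue (ball p (b + 1/2) - ball p a')"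
    using sub assms(2) by (intro measure_mono_fmeasurable) (auto simp: disk_def)
  also have "\<dots> = measure lebesgue (ball p (b + 1/2)) - measure lebesgue (ball p a')"
    using assms by (intro measurable_measure_Diff) (auto simp: a'_def)
  also have "\<dots> = V * ((b + 1/2)^2 - a'^2)"
    using vol[of "b + 1/2" p] vol[of a' p] assms by (simp only: right_diff_distrib) (simp add: a'_def)
  finally have "V * real (card I) \<le> V * (4 * ((b + 1/2)^2 - a'^2))" by (simp add: algebra_simps)
  then have 1: "real (card I) \<le> 4 * ((b + 1/2)^2 - a'^2)"
    using V mult_le_cancel_left_pos by blast
  have "(b + 1/2)^2 - a'^2 \<le> (b - a + 1) * (a + b + 1)"
  proof (cases "a \<ge> 1/2")
    case True
    then have "(b + 1/2)^2 - a'^2 = (b - a + 1) * (a + b)"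
      by (simp add: a'_def power2_eq_square algebra_simps)
    also have "\<dots> \<le> (b - a + 1) * (a + b + 1)"
      using assms by (intro mult_left_mono) auto
    finally show ?thesis .
  next
    case False
    then have "(b + 1/2)^2 - a'^2 = (b + 1/2) * (b + 1/2)"
      by (simp add: a'_def power2_eq_square)
    also have "\<dots> \<le> (b - a + 1) * (a + b + 1)"
      using assms False by (intro mult_mono) auto
    finally show ?thesis .
  qed
  then have "4 * ((b + 1/2)^2 - a'^2) \<le> 4 * ((b - a + 1) * (a + b + 1))" by (rule mult_left_mono) simp
  then show ?thesis using 1 by (simp only: mult.assoc)
qed

lemma packing:
  assumes "penny_configuration c" "0 \<le> a" "a \<le> b"
  shows "finite {i. a \<le> dist (c i) p \<and> dist (c i) p \<le> b}"
    and "real (card {i. a \<le> dist (c i) p \<and> dist (c i) p \<le> b}) \<le> 4 * (b - a + 1) * (a + b + 1)"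
proof -
  let ?I = "{i. a \<le> dist (c i) p \<and> dist (c i) p \<le> b}"
  show fin: "finite ?I"
  proof (rule ccontr)
    assume inf: "infinite ?I"
    define n where "n = nat \<lceil>4 * (b - a + 1) * (a + b + 1)\<rceil> + 1"
    obtain J where J: "J \<subseteq> ?I" "finite J" "card J = n"
      using infinite_arbitrarily_large[OF inf] by metis
    have "real (card J) \<le> 4 * (b - a + 1) * (a + b + 1)"
      using J assms by (intro packing_finite_subset[where p=p and c=c]) auto
    then show False using J(3) unfolding n_def by linarith
  qed
  show "real (card ?I) \<le> 4 * (b - a + 1) * (a + b + 1)"
    using assms fin by (intro packing_finite_subset[where p=p and c=c]) auto
qed

lemma finite_in_cball:
  assumes "penny_configuration c"
  shows "finite {i. dist (c i) p \<le> b}"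
  using packing(1)[OF assms, of 0 "max 0 b" p] by (rule rev_finite_subset) auto

text \<open>
  Stewart's theorem.  As tangent pennies have centres at distance 1 and all others are no closer, it
  controls how close a point of an edge comes to other vertices and edges.
\<close>

lemma dist_convex_combination:
  fixes a b w :: "'a::real_inner"
  shows "(dist ((1 - t) *\<^sub>R a + t *\<^sub>R b) w)\<^sup>2
    = (1 - t) * (dist a w)\<^sup>2 + t * (dist b w)\<^sup>2 - t * (1 - t) * (dist a b)\<^sup>2"
proof -
  have e: "(1 - t) *\<^sub>R a + t *\<^sub>R b - w = (1 - t) *\<^sub>R (a - w) + t *\<^sub>R (b - w)"
    by (simp add: algebra_simps)
  have e': "dist a b = norm ((a - w) - (b - w))" by (simp add: dist_norm)
  show ?thesis
    unfolding e' unfolding dist_norm e power2_norm_eq_inner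
    by (simp add: inner_simps inner_commute) algebra
qed

text \<open>
  A point of a unit segment is within \<open>1/2\<close> of one endpoint, but at squared distance at least \<open>3/4\<close>
  from every vertex that is not an endpoint.
\<close>

lemma edges_meet_imp_common_endpoint:
  assumes "penny_configuration c" "adjacent c i j" "adjacent c k l"
    "z \<in> closed_segment (c i) (c j)" "z \<in> closed_segment (c k) (c l)"
  shows "{i, j} \<inter> {k, l} \<noteq> {}"
proof (rule ccontr)
  assume "\<not> ?thesis"
  then have ne: "i \<noteq> k" "i \<noteq> l" "j \<noteq> k" "j \<noteq> l" by auto
  note d1 = adjacent_dist[OF assms(1,2)] adjacent_dist[OF assms(1,3)]
  obtain t where t: "0 \<le> t" "t \<le> 1" "z = (1 - t) *\<^sub>R c i + t *\<^sub>R c j"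
    using assms(4) by (auto simp: closed_segment_def)
  have far: "(dist z (c m))\<^sup>2 \<ge> 3/4" if "i \<noteq> m" "j \<noteq> m" for m
  proof -
    have "1 \<le> (dist (c i) (c m))\<^sup>2" "1 \<le> (dist (c j) (c m))\<^sup>2"
      using dist_ge_1[OF assms(1)] that by (simp_all add: one_le_power)
    then have "(1 - t) * 1 \<le> (1 - t) * (dist (c i) (c m))\<^sup>2" "t * 1 \<le> t * (dist (c j) (c m))\<^sup>2"
      using t by (intro mult_left_mono; simp)+
    moreover have "t * (1 - t) \<le> 1/4"
      using zero_le_power2[of "t - 1/2"] by (simp add: power2_eq_square algebra_simps)
    ultimately show ?thesis
      unfolding t(3) dist_convex_combination d1 by simp
  qed
  have "dist z (c k) + dist z (c l) = 1"
    using assms(5) d1(2) by (metis between between_mem_segment dist_commute)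
  then have "dist z (c k) \<le> 1/2 \<or> dist z (c l) \<le> 1/2" by linarith
  moreover have "(x::real)\<^sup>2 \<le> 1/4" if "0 \<le> x" "x \<le> 1/2" for x
    using power_mono[OF that(2,1), of 2] by (simp add: power2_eq_square)
  ultimately have "(dist z (c k))\<^sup>2 \<le> 1/4 \<or> (dist z (c l))\<^sup>2 \<le> 1/4" by auto
  then show False using far[OF ne(1,3)] far[OF ne(2,4)] by linarith
qed

text \<open>
  Every vertex other than the two endpoints is at squared distance at least \<open>3/4\<close> from the midpoint, and
  two edges share at most one endpoint.  By Stewart's theorem another edge has squared distance at least
  \<open>3/16\<close> from the midpoint, and \<open>3/16 > 1/16\<close>.
\<close>

lemma near_edge_midpoint:
  assumes "penny_configuration c" "adjacent c i j" "adjacent c k l"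
    "z \<in> closed_segment (c k) (c l)" "dist z (midpoint (c i) (c j)) < 1/4"
  shows "z \<in> closed_segment (c i) (c j)"
proof (rule ccontr)
  assume "z \<notin> closed_segment (c i) (c j)"
  then have ne: "{k, l} \<noteq> {i, j}"
    using assms(4) by (auto simp: doubleton_eq_iff closed_segment_commute)
  define w where "w = midpoint (c i) (c j)"
  note d1 = adjacent_dist[OF assms(1,2)] adjacent_dist[OF assms(1,3)]
  have far: "3/4 \<le> (dist (c m) w)\<^sup>2" if "m \<noteq> i" "m \<noteq> j" for m
  proof -
    have "w = (1 - 1/2) *\<^sub>R c i + (1/2) *\<^sub>R c j"
      by (simp add: w_def midpoint_def algebra_simps)
    then have "(dist w (c m))\<^sup>2 = (1 - 1/2) * (dist (c i) (c m))\<^sup>2 + 1/2 * (dist (c j) (c m))\<^sup>2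
       - 1/2 * (1 - 1/2) * (dist (c i) (c j))\<^sup>2"
      using dist_convex_combination[of "1/2" "c i" "c j" "c m"] by simp
    moreover have "1 \<le> (dist (c i) (c m))\<^sup>2" "1 \<le> (dist (c j) (c m))\<^sup>2"
      using dist_ge_1[OF assms(1)] that by (simp_all add: one_le_power)
    ultimately show ?thesis using d1 by (simp add: dist_commute)
  qed
  have half: "(dist (c m) w)\<^sup>2 = 1/4" if "m = i \<or> m = j" for m
    using that d1 by (auto simp: w_def dist_midpoint power2_eq_square)
  have any: "1/4 \<le> (dist (c m) w)\<^sup>2" for m
    using far[of m] half[of m] by fastforce
  have kl: "k \<noteq> l" using d1(2) by auto
  have far2: "3/4 \<le> (dist (c k) w)\<^sup>2 \<or> 3/4 \<le> (dist (c l) w)\<^sup>2"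
    using ne kl far[of k] far[of l] by auto
  obtain t where t: "0 \<le> t" "t \<le> 1" "z = (1 - t) *\<^sub>R c k + t *\<^sub>R c l"
    using assms(4) by (auto simp: closed_segment_def)
  have "(dist z w)\<^sup>2 = (1 - t) * (dist (c k) w)\<^sup>2 + t * (dist (c l) w)\<^sup>2 - t * (1 - t)"
    unfolding t(3) dist_convex_combination d1 by simp
  moreover have "3/16 \<le> (1 - t) * (dist (c k) w)\<^sup>2 + t * (dist (c l) w)\<^sup>2 - t * (1 - t)"
    using far2
  proof
    assume *: "3/4 \<le> (dist (c k) w)\<^sup>2"
    have "(1 - t) * (3/4) \<le> (1 - t) * (dist (c k) w)\<^sup>2" "t * (1/4) \<le> t * (dist (c l) w)\<^sup>2"
      using t any * by (intro mult_left_mono; simp)+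
    moreover have "(1 - t) * (3/4) + t * (1/4) - t * (1 - t) = (t - 3/4)\<^sup>2 + 3/16"
      by (simp add: power2_eq_square field_simps)
    ultimately show ?thesis using zero_le_power2[of "t - 3/4"] by linarith
  next
    assume *: "3/4 \<le> (dist (c l) w)\<^sup>2"
    have "(1 - t) * (1/4) \<le> (1 - t) * (dist (c k) w)\<^sup>2" "t * (3/4) \<le> t * (dist (c l) w)\<^sup>2"
      using t any * by (intro mult_left_mono; simp)+
    moreover have "(1 - t) * (1/4) + t * (3/4) - t * (1 - t) = (t - 1/4)\<^sup>2 + 3/16"
      by (simp add: power2_eq_square field_simps)
    ultimately show ?thesis using zero_le_power2[of "t - 1/4"] by linarith
  qed
  moreover have "(dist z w)\<^sup>2 < 1/16"
    using power_strict_mono[OF assms(5), of 2] by (simp add: w_def power2_eq_square)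
  ultimately show False by linarith
qed

section \<open>The embedded graph and its faces\<close>

lemma dist_endpoint_le:
  fixes a :: "'a::euclidean_space"
  assumes "y \<in> closed_segment a b"
  shows "dist a y \<le> dist a b"
  using segment_bound1[OF assms] by (simp add: dist_norm norm_minus_commute)

text \<open>
  Connectedness of the subgraph induced on \<open>W\<close>, phrased without paths: no proper nonempty part of \<open>W\<close> is
  closed under adjacency within \<open>W\<close>.  This form matches the topological notion of connectedness, from
  which it is derived below.
\<close>

definition cut_connected :: "(nat \<Rightarrow> real ^ 2) \<Rightarrow> nat set \<Rightarrow> bool" where
  "cut_connected c W \<longleftrightarrow>
    (\<forall>S\<subseteq>W. S \<noteq> {} \<longrightarrow> (\<forall>a\<in>S. \<forall>b\<in>W. adjacent c a b \<longrightarrow> b \<in> S) \<longrightarrow> S = W)"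

locale penny_graph =
  fixes c :: "nat \<Rightarrow> real ^ 2"
  assumes penny: "penny_configuration c" and conn: "graph_connected c"
begin

abbreviation edge :: "nat \<Rightarrow> nat \<Rightarrow> (real ^ 2) set" where
  "edge i j \<equiv> closed_segment (c i) (c j)"

abbreviation G :: "(real ^ 2) set" where
  "G \<equiv> embedded_graph c"

lemmas edge_length = adjacent_dist[OF penny]

lemma has_neighbour: "\<exists>j. adjacent c i j"
proof -
  have "(adjacent c)\<^sup>*\<^sup>* i (Suc i)" using conn by (simp add: graph_connected_def)
  then show ?thesis by (cases rule: converse_rtranclpE) auto
qed

lemma cut_connected_UNIV: "cut_connected c UNIV"
  unfolding cut_connected_def
proof (intro allI impI)
  fix S :: "nat set" assume "S \<noteq> {}" and closed: "\<forall>a\<in>S. \<forall>b\<in>UNIV. adjacent c a b \<longrightarrow> b \<in> S"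
  then obtain a where "a \<in> S" by auto
  have "(adjacent c)\<^sup>*\<^sup>* a b \<Longrightarrow> b \<in> S" for b
    by (induction rule: rtranclp_induct) (use \<open>a \<in> S\<close> closed in auto)
  then show "S = UNIV" using conn by (auto simp: graph_connected_def)
qed

lemma mem_G_iff: "z \<in> G \<longleftrightarrow> (\<exists>i j. adjacent c i j \<and> z \<in> edge i j)"
proof -
  have "\<exists>j. adjacent c i j \<and> c i \<in> edge i j" for i using has_neighbour[of i] by auto
  then show ?thesis unfolding embedded_graph_def by blast
qed

lemma dist_edge: "adjacent c i j \<Longrightarrow> y \<in> edge i j \<Longrightarrow> dist (c i) y \<le> 1"
  using dist_endpoint_le edge_length by metis

lemma finite_edges_near:
  "finite {(i, j). adjacent c i j \<and> edge i j \<inter> ball z 1 \<noteq> {}}"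
proof (rule finite_subset)
  have near: "dist (c i) z \<le> 2" if "adjacent c i j" "y \<in> edge i j" "dist z y < 1" for i j y
    using dist_edge[OF that(1,2)] that(3) dist_triangle2[of "c i" z y] by simp
  show "{(i, j). adjacent c i j \<and> edge i j \<inter> ball z 1 \<noteq> {}}
      \<subseteq> {i. dist (c i) z \<le> 2} \<times> {i. dist (c i) z \<le> 2}"
  proof
    fix p assume "p \<in> {(i, j). adjacent c i j \<and> edge i j \<inter> ball z 1 \<noteq> {}}"
    then obtain i j y where p: "p = (i, j)" and *: "adjacent c i j" "y \<in> edge i j" "y \<in> ball z 1"
      by blast
    then have "adjacent c j i" "y \<in> edge j i" by (simp_all add: adjacent_sym closed_segment_commute)
    then show "p \<in> {i. dist (c i) z \<le> 2} \<times> {i. dist (c i) z \<le> 2}"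
      using p * near[of i j y] near[of j i y] by simp
  qed
  show "finite ({i. dist (c i) z \<le> 2} \<times> {i. dist (c i) z \<le> 2})"
    by (intro finite_cartesian_product finite_in_cball penny)
qed

text \<open>
  Finitely many edges come near \<open>z\<close>, and those that avoid \<open>z\<close> form a closed set.
\<close>

lemma only_incident_edges_near:
  obtains \<epsilon> where "\<epsilon> > 0"
    "\<And>i j y. adjacent c i j \<Longrightarrow> y \<in> edge i j \<Longrightarrow> dist z y < \<epsilon> \<Longrightarrow> z \<in> edge i j"
proof -
  define P where "P = {(i, j). adjacent c i j \<and> edge i j \<inter> ball z 1 \<noteq> {}} \<inter> {(i, j). z \<notin> edge i j}"
  define U where "U = (\<Union>(i, j)\<in>P. edge i j)"
  have "finite P" using finite_edges_near by (simp add: P_def)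
  then have "closed U" unfolding U_def by (intro closed_UN) auto
  moreover have "z \<notin> U" by (auto simp: U_def P_def)
  ultimately obtain e where e: "e > 0" "ball z e \<subseteq> - U"
    by (meson ComplI open_Compl open_contains_ball)
  show thesis
  proof (rule that[of "min e 1"])
    fix i j y assume "adjacent c i j" "y \<in> edge i j" "dist z y < min e 1"
    then show "z \<in> edge i j"
      using e(2) by (force simp: U_def P_def)
  qed (use e in auto)
qed

lemma closed_G: "closed G"
proof -
  have "\<exists>e>0. ball z e \<subseteq> - G" if z: "z \<in> - G" for z
  proof -
    obtain e where "e > 0"
      "\<And>i j y. adjacent c i j \<Longrightarrow> y \<in> edge i j \<Longrightarrow> dist z y < e \<Longrightarrow> z \<in> edge i j"
      using only_incident_edges_near by metis
    then show ?thesis using z by (force simp: mem_G_iff)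
  qed
  then show ?thesis by (simp add: closed_def open_contains_ball)
qed

lemma connected_G: "connected G"
proof -
  have seg: "connected_component G (c i) y" if "adjacent c i j" "y \<in> edge i j" for i j y
    unfolding connected_component_def
    by (intro exI[of _ "edge i j"]) (use that mem_G_iff in \<open>blast intro: ends_in_segment\<close>)
  have "(adjacent c)\<^sup>*\<^sup>* i j \<Longrightarrow> connected_component G (c i) (c j)" for i j
  proof (induction rule: rtranclp_induct)
    case base
    show ?case using has_neighbour[of i] by (auto simp: mem_G_iff)
  next
    case (step k l)
    then show ?case using seg[of k l "c l"] connected_component_trans by fastforce
  qed
  then have v: "connected_component G (c i) (c j)" for i j
    using conn by (simp add: graph_connected_def)
  have "connected_component G (c 0) y" if "y \<in> G" for y
    using that v[of 0] seg connected_component_trans unfolding mem_G_iff by metis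
  then show ?thesis
    unfolding connected_iff_connected_component
    using connected_component_sym connected_component_trans by metis
qed

lemma vertices_unbounded: "\<exists>i. dist (c i) p > r"
proof (rule ccontr)
  assume "\<not> ?thesis"
  then have "{i. dist (c i) p \<le> r} = UNIV" by (auto simp: not_less)
  then show False using finite_in_cball[OF penny, of p r] by simp
qed

lemma vertex_in_G: "c i \<in> G"
  by (auto simp: embedded_graph_def)

lemma face_in_complement: "\<sigma> \<in> faces c \<Longrightarrow> \<sigma> \<subseteq> - G"
  unfolding faces_def by (rule in_components_subset)

lemma frontier_face_subset: "\<sigma> \<in> faces c \<Longrightarrow> frontier \<sigma> \<subseteq> G"
  unfolding faces_def by (rule frontier_of_components_closed_complement[OF closed_G])

lemma connected_frontier_face: "\<sigma> \<in> faces c \<Longrightarrow> connected (frontier \<sigma>)"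
  unfolding faces_def by (rule connected_frontier_component_complement[OF connected_G])

lemma frontier_face_nonempty: "\<sigma> \<in> faces c \<Longrightarrow> frontier \<sigma> \<noteq> {}"
  using face_in_complement[of \<sigma>] vertex_in_G in_components_nonempty[of \<sigma>]
  unfolding faces_def frontier_eq_empty by blast

lemma connected_subset_face:
  assumes "\<sigma> \<in> faces c" "connected T" "T \<subseteq> - G" "T \<inter> \<sigma> \<noteq> {}"
  shows "T \<subseteq> \<sigma>"
  using assms unfolding faces_def by (metis components_maximal inf_commute)

text \<open>
  The sector of the disk that contains \<open>q\<close> is connected and avoids the graph, so it stays in the face.
\<close>

lemma corner_at:
  assumes "\<sigma> \<in> faces c" "q \<in> \<sigma>" "q \<in> disk c i"
  shows "i \<in> fst ` corners c \<sigma>"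
proof -
  define S where "S = connected_component_set (disk c i - G) q"
  have q: "q \<in> disk c i - G" using assms face_in_complement by blast
  then have "S \<in> components (disk c i - G)" by (simp add: S_def componentsI)
  moreover have "S \<subseteq> \<sigma>"
  proof (rule connected_subset_face[OF assms(1)])
    show "connected S" by (simp add: S_def)
    show "S \<subseteq> - G" using connected_component_subset[of "disk c i - G" q] by (auto simp: S_def)
    have "q \<in> S" using q by (simp add: S_def)
    then show "S \<inter> \<sigma> \<noteq> {}" using assms(2) by blast
  qed
  ultimately show ?thesis unfolding corners_def by force
qed

text \<open>
  The midpoint of an edge is the only point of it outside both open disks.  Near the midpoint the graph
  is a straight segment, so a point \<open>q\<close> of the face can be moved alongside the edge, without
  crossing the graph, until it enters the disk about \<open>c i\<close>.
\<close>

lemma face_reaches_disk_from_edge_midpoint: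
  assumes face: "\<sigma> \<in> faces c" and adj: "adjacent c i j"
    and mid: "midpoint (c i) (c j) \<in> frontier \<sigma>"
  shows "\<sigma> \<inter> disk c i \<noteq> {}"
proof -
  define w where "w = midpoint (c i) (c j)"
  define v where "v = c i - w"
  have ends: "c i = w + v" "c j = w - v"
    by (simp_all add: v_def w_def midpoint_def algebra_simps flip: scaleR_add_left)
  have nv: "norm v = 1/2"
    using edge_length[OF adj] dist_midpoint(1)[of "c i" "c j"] by (simp add: v_def w_def dist_norm norm_minus_commute)
  obtain q where q: "q \<in> \<sigma>" "dist q w < 1/4"
    using mid unfolding w_def frontier_def closure_approachable by (metis DiffD1 zero_less_divide_1_iff zero_less_numeral closure_approachable)
  then have nq: "norm (q - w) < 1/4" and qG: "q \<notin> G"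
    using face_in_complement[OF face] by (auto simp: dist_norm)
  \<comment> \<open>moved towards \<open>c i\<close> by a quarter of \<open>v\<close>; shrinking \<open>q - w\<close> at the same time keeps the whole path
    within \<open>1/4\<close> of \<open>w\<close>\<close>
  define q' where "q' = w + (1/4) *\<^sub>R (q - w) + (1/4) *\<^sub>R v"
  have "closed_segment q q' \<subseteq> - G"
  proof
    fix y assume "y \<in> closed_segment q q'"
    then obtain t where t: "0 \<le> t" "t \<le> 1" "y = (1 - t) *\<^sub>R q + t *\<^sub>R q'"
      by (auto simp: closed_segment_def)
    define \<alpha> \<beta> where "\<alpha> = (1 - t) + t/4" and "\<beta> = t/4"
    have \<alpha>: "\<alpha> > 0" using t by (auto simp: \<alpha>_def)
    have y: "y - w = \<alpha> *\<^sub>R (q - w) + \<beta> *\<^sub>R v"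
      by (simp add: t(3) q'_def \<alpha>_def \<beta>_def vec_eq_iff field_simps)
    have "norm (y - w) \<le> \<alpha> * norm (q - w) + \<beta> * (1/2)"
      unfolding y using norm_triangle_ineq[of "\<alpha> *\<^sub>R (q - w)" "\<beta> *\<^sub>R v"] \<alpha> t nv by (simp add: \<beta>_def)
    also have "\<dots> < \<alpha> * (1/4) + \<beta> * (1/2)"
      using mult_strict_left_mono[OF nq \<alpha>] by simp
    also have "\<dots> \<le> 1/4" using t(1) by (simp add: \<alpha>_def \<beta>_def field_simps)
    finally have near: "dist y w < 1/4" by (simp add: dist_norm)
    show "y \<in> - G"
    proof
      assume "y \<in> G"
      then obtain k l where "adjacent c k l" "y \<in> edge k l" by (auto simp: mem_G_iff)
      then have "y \<in> edge i j" using near_edge_midpoint[OF penny adj] near by (simp add: w_def)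
      then obtain s where s: "y = (1 - s) *\<^sub>R c i + s *\<^sub>R c j" by (auto simp: closed_segment_def)
      have yv: "y - w = (1 - 2 * s) *\<^sub>R v" by (simp add: s ends vec_eq_iff algebra_simps)
      \<comment> \<open>if the path met the edge, \<open>q\<close> would lie on the line of the edge, and within it\<close>
      define \<delta> where "\<delta> = (1 - 2 * s - \<beta>) / \<alpha>"
      have "\<alpha> *\<^sub>R (q - w) = (1 - 2 * s - \<beta>) *\<^sub>R v" using y yv by (simp add: algebra_simps)
      also have "\<dots> = \<alpha> *\<^sub>R (\<delta> *\<^sub>R v)" using \<alpha> by (simp add: \<delta>_def)
      finally have qw: "q - w = \<delta> *\<^sub>R v" using \<alpha> by (metis less_irrefl scaleR_cancel_left)
      then have \<delta>: "\<bar>\<delta>\<bar> < 1/2" using nq nv by simp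
      have "q = w + \<delta> *\<^sub>R v" using qw by (simp add: algebra_simps)
      also have "\<dots> = (1 - (1 - \<delta>)/2) *\<^sub>R c i + ((1 - \<delta>)/2) *\<^sub>R c j"
        by (simp add: ends vec_eq_iff field_simps)
      finally have "q \<in> edge i j"
        unfolding closed_segment_def using \<delta> by (intro CollectI exI[of _ "(1 - \<delta>)/2"]) auto
      then show False using qG adj by (auto simp: mem_G_iff)
    qed
  qed
  then have "closed_segment q q' \<subseteq> \<sigma>"
    using q(1) by (intro connected_subset_face[OF face]) auto
  then have "q' \<in> \<sigma>" by auto
  moreover have "q' \<in> disk c i"
  proof -
    have "q' - c i = (1/4) *\<^sub>R (q - w) - (3/4) *\<^sub>R v"
      by (simp add: q'_def ends algebra_simps flip: scaleR_add_left)
    then have "norm (q' - c i) \<le> 1/4 * norm (q - w) + 3/4 * norm v"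
      using norm_triangle_ineq4[of "(1/4) *\<^sub>R (q - w)" "(3/4) *\<^sub>R v"] by simp
    then show ?thesis using nq nv by (simp add: disk_def dist_norm norm_minus_commute)
  qed
  ultimately show ?thesis by blast
qed

lemma frontier_near_corner:
  assumes face: "\<sigma> \<in> faces c" and w: "w \<in> frontier \<sigma>"
  shows "\<exists>i\<in>fst ` corners c \<sigma>. dist (c i) w \<le> 1"
proof -
  obtain i j where ij: "adjacent c i j" "w \<in> edge i j"
    using w frontier_face_subset[OF face] mem_G_iff by blast
  have corner: "k \<in> fst ` corners c \<sigma>" if "\<sigma> \<inter> disk c k \<noteq> {}" for k
    using corner_at[OF face] that by blast
  have inside: "\<sigma> \<inter> disk c k \<noteq> {}" if "w \<in> disk c k" for k
  proof -
    have "disk c k \<inter> closure \<sigma> \<noteq> {}" using w that by (auto simp: frontier_def)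
    then show ?thesis
      using open_Int_closure_eq_empty[of "disk c k" \<sigma>] by (simp add: disk_def Int_commute)
  qed
  have sum: "dist (c i) w + dist w (c j) = 1"
    using ij edge_length by (metis between between_mem_segment)
  show ?thesis
  proof (cases "w = midpoint (c i) (c j)")
    case True
    then show ?thesis
      using corner[OF face_reaches_disk_from_edge_midpoint[OF face ij(1)]] w dist_edge[OF ij] by auto
  next
    case False
    have "dist (c i) w \<noteq> 1/2"
    proof
      assume half: "dist (c i) w = 1/2"
      obtain t where t: "0 \<le> t" "w = (1 - t) *\<^sub>R c i + t *\<^sub>R c j"
        using ij(2) by (auto simp: closed_segment_def)
      have "dist (c i) w = norm (t *\<^sub>R (c i - c j))" by (simp add: t(2) dist_norm algebra_simps)
      then have t2: "t = 1/2" using half edge_length[OF ij(1)] t(1) by (simp add: dist_norm)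
      have "w = midpoint (c i) (c j)" unfolding t(2) t2 by (simp add: midpoint_def vec_eq_iff field_simps)
      then show False using False by simp
    qed
    then have "w \<in> disk c i \<or> w \<in> disk c j"
      using sum by (auto simp: disk_def dist_commute)
    then show ?thesis
      using corner inside sum zero_le_dist[of "c i" w] zero_le_dist[of w "c j"]
      by (metis dist_commute le_add_same_cancel1 le_add_same_cancel2)
  qed
qed

section \<open>Connected sets of points and connected sets of vertices\<close>

definition endpoints_meeting :: "(real ^ 2) set \<Rightarrow> nat set" where
  "endpoints_meeting X = {i. \<exists>j. adjacent c i j \<and> edge i j \<inter> X \<noteq> {}}"

lemma endpoints_meetingI:
  assumes "adjacent c i j" "x \<in> edge i j" "x \<in> X"
  shows "i \<in> endpoints_meeting X" "j \<in> endpoints_meeting X"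
proof -
  have "adjacent c j i" "x \<in> edge j i"
    using assms by (simp_all add: adjacent_sym closed_segment_commute)
  then show "i \<in> endpoints_meeting X" "j \<in> endpoints_meeting X"
    using assms unfolding endpoints_meeting_def by blast+
qed

text \<open>
  Let \<open>S\<close> be closed under adjacency.  Since two edges through the same point share an endpoint, either all
  or none of the endpoints of edges through a point of \<open>X\<close> belong to \<open>S\<close>.  Which of the two holds is
  locally constant along \<open>X\<close>, because the edges meeting a small neighbourhood of a point all contain it.
\<close>

lemma cut_connected_endpoints_meeting:
  assumes "connected X" "X \<subseteq> G"
  shows "cut_connected c (endpoints_meeting X)"
  unfolding cut_connected_def
proof (intro allI impI)
  fix S assume S: "S \<subseteq> endpoints_meeting X" "S \<noteq> {}"
    and closed: "\<forall>a\<in>S. \<forall>b\<in>endpoints_meeting X. adjacent c a b \<longrightarrow> b \<in> S"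
  define f where "f x \<longleftrightarrow> (\<exists>i j. i \<in> S \<and> adjacent c i j \<and> x \<in> edge i j)" for x
  have spread: "k \<in> S" if "f x" "x \<in> X" "adjacent c k l" "x \<in> edge k l" for x k l
  proof -
    obtain i j where ij: "i \<in> S" "adjacent c i j" "x \<in> edge i j" using \<open>f x\<close> by (auto simp: f_def)
    then have "j \<in> S" using closed endpoints_meetingI[OF ij(2,3) that(2)] by blast
    then have "k \<in> S \<or> l \<in> S"
      using edges_meet_imp_common_endpoint[OF penny ij(2) that(3) ij(3) that(4)] ij(1) by auto
    then show ?thesis
      using closed endpoints_meetingI[OF that(3,4,2)] that(3) adjacent_sym by blast
  qed
  have const: "f x = f y" if "x \<in> X" "y \<in> X" for x y
  proof (rule connected_local_const[OF assms(1) that])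
    show "\<forall>x\<in>X. eventually (\<lambda>y. f x = f y) (at x within X)"
    proof
      fix x assume x: "x \<in> X"
      obtain e where e: "e > 0"
        "\<And>i j y. adjacent c i j \<Longrightarrow> y \<in> edge i j \<Longrightarrow> dist x y < e \<Longrightarrow> x \<in> edge i j"
        using only_incident_edges_near by metis
      have "f x = f y" if y: "y \<in> X" "dist y x < e" for y
      proof
        assume "f x"
        obtain k l where kl: "adjacent c k l" "y \<in> edge k l"
          using y(1) assms(2) mem_G_iff by blast
        then have "x \<in> edge k l" using e(2) y(2) by (simp add: dist_commute)
        then show "f y" using spread[OF \<open>f x\<close> x kl(1)] kl by (auto simp: f_def)
      next
        assume "f y"
        then show "f x" using e(2) y(2) unfolding f_def by (metis dist_commute)
      qed
      then show "eventually (\<lambda>y. f x = f y) (at x within X)"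
        using e(1) unfolding eventually_at by blast
    qed
  qed
  obtain i j x where "i \<in> S" "adjacent c i j" "x \<in> edge i j" "x \<in> X"
    using S by (fastforce simp: endpoints_meeting_def)
  then have fx: "f x" "x \<in> X" by (auto simp: f_def)
  have "k \<in> S" if "k \<in> endpoints_meeting X" for k
  proof -
    from that obtain l y where kl: "adjacent c k l" "y \<in> edge k l" "y \<in> X"
      unfolding endpoints_meeting_def by blast
    then show ?thesis using spread[of y k l] const[OF fx(2) kl(3)] fx(1) by blast
  qed
  then show "S = endpoints_meeting X" using S by blast
qed

text \<open>
  The part of the graph that is seen from \<open>z\<close>: the point itself if \<open>z\<close> lies on the graph, otherwise the
  boundary of the face around \<open>z\<close>.  In both cases it is a nonempty connected subset of the graph.
\<close>

definition boundary_at :: "real ^ 2 \<Rightarrow> (real ^ 2) set" where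
  "boundary_at z = (if z \<in> G then {z} else frontier (connected_component_set (- G) z))"

lemma component_face: "z \<notin> G \<Longrightarrow> connected_component_set (- G) z \<in> faces c"
  by (simp add: faces_def componentsI)

lemma boundary_at: "connected (boundary_at z)" "boundary_at z \<subseteq> G" "boundary_at z \<noteq> {}"
  using component_face[of z] connected_frontier_face frontier_face_subset frontier_face_nonempty
  by (auto simp: boundary_at_def)

definition nearby :: "real ^ 2 \<Rightarrow> nat set" where
  "nearby z = endpoints_meeting (boundary_at z)"

lemma nearby_nonempty: "nearby z \<noteq> {}"
proof -
  obtain x where "x \<in> boundary_at z" "x \<in> G" using boundary_at by blast
  then show ?thesis
    unfolding nearby_def mem_G_iff using endpoints_meetingI by blast
qed

text \<open>
  Inside a face \<open>nearby\<close> is constant.  If \<open>z\<close> lies on the graph and \<open>y\<close> is close to it, the segment from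
  \<open>z\<close> to \<open>y\<close> meets the boundary of the face of \<open>y\<close> on an edge so close to \<open>z\<close> that it must contain \<open>z\<close>.
\<close>

lemma nearby_overlap:
  "eventually (\<lambda>y. nearby z \<inter> nearby y \<noteq> {}) (at z within Z)"
proof (cases "z \<in> G")
  case False
  define C where "C = connected_component_set (- G) z"
  have "open C" using closed_G by (simp add: C_def open_connected_component open_Compl)
  moreover have "z \<in> C" using False by (simp add: C_def)
  ultimately have "eventually (\<lambda>y. y \<in> C) (at z within Z)"
    by (meson eventually_at_topological)
  then show ?thesis
  proof eventually_elim
    case (elim y)
    then have "connected_component_set (- G) y = C" unfolding C_def by (metis connected_component_eq)
    moreover have "y \<notin> G" using elim connected_component_subset[of "- G" z] by (auto simp: C_def)
    ultimately have "nearby y = nearby z" using False by (simp add: nearby_def boundary_at_def C_def)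
    then show ?case using nearby_nonempty by simp
  qed
next
  case True
  obtain e where e: "e > 0"
    "\<And>i j y. adjacent c i j \<Longrightarrow> y \<in> edge i j \<Longrightarrow> dist z y < e \<Longrightarrow> z \<in> edge i j"
    using only_incident_edges_near by metis
  have "nearby z \<inter> nearby y \<noteq> {}" if "dist y z < e" for y
  proof -
    have "\<exists>x. x \<in> boundary_at y \<and> dist z x < e"
    proof (cases "y \<in> G")
      case True
      then show ?thesis using that by (auto simp: boundary_at_def dist_commute)
    next
      case False
      define C where "C = connected_component_set (- G) y"
      have "z \<notin> C" using True connected_component_subset[of "- G" y] by (auto simp: C_def)
      moreover have "y \<in> C" using False by (simp add: C_def)
      ultimately obtain x where x: "x \<in> closed_segment z y" "x \<in> frontier C"
        using connected_Int_frontier[of "closed_segment z y" C] by auto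
      then show ?thesis
        using False that dist_endpoint_le[OF x(1)] by (auto simp: boundary_at_def C_def dist_commute)
    qed
    then obtain x where x: "x \<in> boundary_at y" "dist z x < e" by blast
    obtain i j where ij: "adjacent c i j" "x \<in> edge i j"
      using x(1) boundary_at(2) mem_G_iff by blast
    have "i \<in> nearby y" unfolding nearby_def using endpoints_meetingI(1)[OF ij x(1)] .
    moreover have "i \<in> nearby z"
      unfolding nearby_def
      using endpoints_meetingI(1)[OF ij(1) e(2)[OF ij x(2)]] True by (simp add: boundary_at_def)
    ultimately show ?thesis by blast
  qed
  then show ?thesis using e(1) unfolding eventually_at by blast
qed

text \<open>
  The argument of \<open>cut_connected_endpoints_meeting\<close> one level up: whether \<open>nearby z\<close> belongs to an
  adjacency-closed set is an all-or-nothing property that is locally constant in \<open>z\<close>.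
\<close>

lemma cut_connected_nearby:
  assumes "connected Z"
  shows "cut_connected c (\<Union>z\<in>Z. nearby z)"
  unfolding cut_connected_def
proof (intro allI impI)
  let ?W = "\<Union>z\<in>Z. nearby z"
  fix S assume S: "S \<subseteq> ?W" "S \<noteq> {}"
    and closed: "\<forall>a\<in>S. \<forall>b\<in>?W. adjacent c a b \<longrightarrow> b \<in> S"
  define f where "f z \<longleftrightarrow> nearby z \<inter> S \<noteq> {}" for z
  have all: "nearby z \<subseteq> S" if "z \<in> Z" "f z" for z
  proof -
    have "cut_connected c (nearby z)"
      unfolding nearby_def by (intro cut_connected_endpoints_meeting boundary_at)
    moreover have "\<forall>a\<in>nearby z \<inter> S. \<forall>b\<in>nearby z. adjacent c a b \<longrightarrow> b \<in> nearby z \<inter> S"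
      using closed that(1) by blast
    ultimately have "nearby z \<inter> S = nearby z"
      using that(2) unfolding cut_connected_def f_def by (meson inf_le1)
    then show ?thesis by blast
  qed
  have const: "f x = f y" if "x \<in> Z" "y \<in> Z" for x y
  proof (rule connected_local_const[OF assms that])
    show "\<forall>x\<in>Z. eventually (\<lambda>y. f x = f y) (at x within Z)"
    proof
      fix x assume x: "x \<in> Z"
      have "eventually (\<lambda>y. nearby x \<inter> nearby y \<noteq> {} \<and> y \<in> Z) (at x within Z)"
        using nearby_overlap[of x Z] by (auto simp: eventually_at_filter elim: eventually_mono)
      then show "eventually (\<lambda>y. f x = f y) (at x within Z)"
      proof eventually_elim
        case (elim y)
        then show ?case using all[OF x] all[of y] unfolding f_def by blast
      qed
    qed
  qed
  obtain z where "z \<in> Z" "f z" using S unfolding f_def by blast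
  then have "?W \<subseteq> S" using const all by blast
  then show "S = ?W" using S by blast
qed

end

text \<open>
  Radius \<open>3 * D + 3\<close> of a ball containing a face, plus the length 1 of an edge that meets its boundary.
\<close>

definition nearby_radius :: "nat \<Rightarrow> real" where
  "nearby_radius D = 3 * real D + 4"

locale bounded_penny_graph = penny_graph +
  fixes D :: nat
  assumes facial_degree_le: "\<And>\<sigma>. \<sigma> \<in> faces c \<Longrightarrow> facial_degree c \<sigma> \<le> enat D"
begin

lemma corner_vertices:
  assumes "\<sigma> \<in> faces c"
  shows "finite (fst ` corners c \<sigma>)" "card (fst ` corners c \<sigma>) \<le> D"
proof -
  have "finite (corners c \<sigma>) \<and> card (corners c \<sigma>) \<le> D"
    using facial_degree_le[OF assms] by (auto simp: facial_degree_def split: if_splits)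
  then show "finite (fst ` corners c \<sigma>)" "card (fst ` corners c \<sigma>) \<le> D"
    using card_image_le[of "corners c \<sigma>" fst] by auto
qed

text \<open>
  The boundary is covered by at most \<open>D\<close> disks of radius 1, and each of them meets at most one of the
  \<open>D + 1\<close> circles, whose radii are 3 apart.
\<close>

lemma circle_missing_frontier:
  assumes "\<sigma> \<in> faces c"
  shows "\<exists>n\<in>{1..D + 1}. sphere w (3 * real n) \<inter> frontier \<sigma> = {}"
proof (rule ccontr)
  assume "\<not> ?thesis"
  then have "\<exists>y. y \<in> frontier \<sigma> \<and> dist w y = 3 * real n" if "n \<in> {1..D + 1}" for n
    using that by fastforce
  then have "\<exists>i\<in>fst ` corners c \<sigma>. \<bar>dist (c i) w - 3 * real n\<bar> \<le> 1" if n: "n \<in> {1..D + 1}" for n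
  proof -
    obtain y where y: "y \<in> frontier \<sigma>" "dist w y = 3 * real n" using \<open>n \<in> _ \<Longrightarrow> _\<close> n by blast
    obtain i where i: "i \<in> fst ` corners c \<sigma>" "dist (c i) y \<le> 1"
      using frontier_near_corner[OF assms y(1)] by blast
    have "\<bar>dist (c i) w - dist w y\<bar> \<le> dist (c i) y" by metric
    then show ?thesis using i y(2) by (intro bexI[OF _ i(1)]) linarith
  qed
  then obtain g where g: "\<And>n. n \<in> {1..D + 1} \<Longrightarrow> g n \<in> fst ` corners c \<sigma>"
    "\<And>n. n \<in> {1..D + 1} \<Longrightarrow> \<bar>dist (c (g n)) w - 3 * real n\<bar> \<le> 1" by metis
  have "inj_on g {1..D + 1}"
  proof (rule inj_onI)
    fix m n assume *: "m \<in> {1..D + 1}" "n \<in> {1..D + 1}" "g m = g n"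
    then have "\<bar>3 * real m - 3 * real n\<bar> \<le> 2" using g(2)[OF *(1)] g(2)[OF *(2)] by simp
    then show "m = n" by linarith
  qed
  then have "card {1..D + 1} \<le> card (fst ` corners c \<sigma>)"
    using g(1) corner_vertices(1)[OF assms] by (intro card_inj_on_le[of g]) auto
  then show False using corner_vertices(2)[OF assms] by simp
qed

text \<open>
  Take a circle about \<open>w\<close> that misses the boundary of the face.  If it met the face, it would lie in the
  face and so separate the point \<open>w\<close> of the connected graph from its far vertices.  So it is disjoint
  from the face, which is connected and has points near \<open>w\<close>.
\<close>

lemma face_subset_ball:
  assumes face: "\<sigma> \<in> faces c" and w: "w \<in> frontier \<sigma>"
  shows "\<sigma> \<subseteq> ball w (3 * real D + 3)"
proof -
  obtain n where n: "n \<in> {1..D + 1}" "sphere w (3 * real n) \<inter> frontier \<sigma> = {}"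
    using circle_missing_frontier[OF face] by blast
  let ?B = "ball w (3 * real n)"
  have r: "3 * real n > 0" "3 * real n \<le> 3 * real D + 3" using n(1) by auto
  have frB: "frontier ?B = sphere w (3 * real n)" using r by simp
  have "sphere w (3 * real n) \<inter> \<sigma> = {}"
  proof (rule ccontr)
    assume *: "sphere w (3 * real n) \<inter> \<sigma> \<noteq> {}"
    have "connected (sphere w (3 * real n))" by (intro connected_sphere) simp
    then have "sphere w (3 * real n) \<subseteq> \<sigma>" using connected_Int_frontier * n(2) by blast
    then have "G \<inter> frontier ?B = {}" using face_in_complement[OF face] frB by auto
    moreover have "w \<in> G \<inter> ?B" using w frontier_face_subset[OF face] r by auto
    moreover have "\<exists>i. c i \<in> G - ?B"
      using vertices_unbounded[where r = "3 * real n" and p = w] vertex_in_G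
      by (simp add: dist_commute not_less) (metis less_imp_le)
    ultimately show False using connected_Int_frontier[OF connected_G] by blast
  qed
  moreover have "\<sigma> \<inter> ?B \<noteq> {}"
  proof -
    have "w \<in> closure \<sigma> \<inter> ?B" using w r(1) by (simp add: frontier_def)
    then show ?thesis using open_Int_closure_eq_empty[OF open_ball, of w "3 * real n" \<sigma>] by blast
  qed
  moreover have "connected \<sigma>" using face unfolding faces_def by (rule in_components_connected)
  ultimately have "\<sigma> \<subseteq> ?B" using connected_Int_frontier[of \<sigma> ?B] frB by blast
  then show ?thesis using r(2) by auto
qed

abbreviation M :: real where "M \<equiv> nearby_radius D"

lemma dist_nearby_le:
  assumes "i \<in> nearby z"
  shows "dist (c i) z \<le> M"
proof -
  obtain j y where y: "adjacent c i j" "y \<in> edge i j" "y \<in> boundary_at z"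
    using assms unfolding nearby_def endpoints_meeting_def by blast
  note d = dist_edge[OF y(1,2)]
  have "dist y z \<le> 3 * real D + 3"
  proof (cases "z \<in> G")
    case True
    then show ?thesis using y(3) by (simp add: boundary_at_def)
  next
    case False
    have "connected_component_set (- G) z \<subseteq> ball y (3 * real D + 3)"
      using face_subset_ball[OF component_face[OF False]] y(3) False by (simp add: boundary_at_def)
    moreover have "z \<in> connected_component_set (- G) z" using False by simp
    ultimately show ?thesis by (metis in_mono less_imp_le mem_ball)
  qed
  then show ?thesis using d dist_triangle[of "c i" z y] by (simp add: nearby_radius_def)
qed

text \<open>
  Apart from packing, the only property of the embedding that the analysis uses.  For a circle \<open>Z\<close> it provides the chains of
  the mean value inequality, for a segment a bound on graph distances.
\<close>

lemma coarse_neighbourhood: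
  assumes "connected Z"
  obtains W where "cut_connected c W"
    "\<And>i. i \<in> W \<Longrightarrow> \<exists>z\<in>Z. dist (c i) z \<le> M"
    "\<And>z. z \<in> Z \<Longrightarrow> \<exists>i\<in>W. dist (c i) z \<le> M"
    "\<And>i j. adjacent c i j \<Longrightarrow> edge i j \<inter> Z \<noteq> {} \<Longrightarrow> i \<in> W \<and> j \<in> W"
proof (rule that[OF cut_connected_nearby[OF assms]])
  show "\<And>i. i \<in> (\<Union>z\<in>Z. nearby z) \<Longrightarrow> \<exists>z\<in>Z. dist (c i) z \<le> M" using dist_nearby_le by blast
  show "\<exists>i\<in>\<Union>z\<in>Z. nearby z. dist (c i) z \<le> M" if "z \<in> Z" for z
    using that dist_nearby_le nearby_nonempty[of z] by blast
  fix i j assume ij: "adjacent c i j" "edge i j \<inter> Z \<noteq> {}"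
  then obtain z where z: "z \<in> edge i j" "z \<in> Z" by blast
  then have "z \<in> boundary_at z" using ij mem_G_iff by (auto simp: boundary_at_def)
  then show "i \<in> (\<Union>z\<in>Z. nearby z) \<and> j \<in> (\<Union>z\<in>Z. nearby z)"
    using endpoints_meetingI[OF ij(1) z(1)] z(2) by (auto simp: nearby_def)
qed

end

section \<open>Harmonic functions, oscillation and energy\<close>

text \<open>
  Induction along a connected set of vertices, adding one adjacent vertex at a time.  It replaces the choice
  of simple paths in the three estimates that follow from it.
\<close>

lemma (in penny_graph) cut_connected_grow:
  assumes "cut_connected c W" "finite W" "p \<in> W" "P {p}"
    and step: "\<And>S a b. \<lbrakk>S \<subseteq> W; p \<in> S; P S; a \<in> S; b \<in> W - S; adjacent c a b\<rbrakk> \<Longrightarrow> P (insert b S)"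
  shows "P W"
proof -
  let ?A = "{S. S \<subseteq> W \<and> p \<in> S \<and> P S}"
  have "finite ?A" using assms(2) by (intro finite_subset[of ?A "Pow W"]) auto
  moreover have "{p} \<in> ?A" using assms by simp
  ultimately have "\<exists>S\<in>?A. \<forall>S'\<in>?A. S \<subseteq> S' \<longrightarrow> S = S'"
    by (intro finite_has_maximal) auto
  then obtain S where "S \<in> ?A" and max: "\<forall>S'\<in>?A. S \<subseteq> S' \<longrightarrow> S = S'" by (rule bexE)
  then have S: "S \<subseteq> W" "p \<in> S" "P S" by simp_all
  have "b \<in> S" if ab: "a \<in> S" "b \<in> W" "adjacent c a b" for a b
  proof (rule ccontr)
    assume "b \<notin> S"
    then have "P (insert b S)" using step[OF S ab(1) _ ab(3)] ab(2) by simp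
    then have "insert b S \<in> ?A" using S(1,2) ab(2) by simp
    with max have "S \<subseteq> insert b S \<longrightarrow> S = insert b S" by (rule bspec)
    then have "S = insert b S" using subset_insertI by (rule mp)
    then show False using \<open>b \<notin> S\<close> by (metis insertI1)
  qed
  then have "S = W" using assms(1) S(1,2) unfolding cut_connected_def by blast
  then show ?thesis using S by simp
qed

text \<open>
  Ordered pairs, so that every edge occurs in both directions and sums over edges can be symmetrised by
  swapping the components.
\<close>

definition edges_in :: "(nat \<Rightarrow> real ^ 2) \<Rightarrow> nat set \<Rightarrow> (nat \<times> nat) set" where
  "edges_in c S = {(a, b). a \<in> S \<and> b \<in> S \<and> adjacent c a b}"

definition energy :: "(nat \<Rightarrow> real ^ 2) \<Rightarrow> nat set \<Rightarrow> (nat \<Rightarrow> real) \<Rightarrow> real" where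
  "energy c S u = (\<Sum>(a, b)\<in>edges_in c S. (u a - u b)\<^sup>2)"

lemma edges_in_Sigma: "edges_in c S = (SIGMA a:S. {b \<in> S. adjacent c a b})"
  by (auto simp: edges_in_def)

lemma finite_edges_in: "finite S \<Longrightarrow> finite (edges_in c S)"
  by (simp add: edges_in_Sigma)

lemma sum_edges_in_swap:
  "(\<Sum>(a, b)\<in>edges_in c S. f b a) = (\<Sum>(a, b)\<in>edges_in c S. f a b)"
  by (rule sum.reindex_bij_witness[of _ prod.swap prod.swap])
    (auto simp: edges_in_def adjacent_sym)

context penny_graph
begin

lemma degree_le: "card {b. adjacent c a b} \<le> 12"
proof -
  have "dist (c b) (c a) = 1" if "adjacent c a b" for b
    using edge_length[OF that] by (simp add: dist_commute)
  then have "real (card {b. adjacent c a b}) \<le> real (card {b. 1 \<le> dist (c b) (c a) \<and> dist (c b) (c a) \<le> 1})"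
    using packing(1)[OF penny, of 1 1 "c a"] by (intro of_nat_mono card_mono) auto
  also have "\<dots> \<le> 12" using packing(2)[OF penny, of 1 1 "c a"] by simp
  finally show ?thesis by simp
qed

lemma degree_in_le: "card {b \<in> S. adjacent c a b} \<le> 12"
  using card_mono[OF finite_neighbours[OF penny], of "{b \<in> S. adjacent c a b}" a] degree_le[of a]
  by fastforce

lemma sum_edges_in_le:
  fixes f :: "nat \<Rightarrow> real"
  assumes "finite S" "\<And>a. f a \<ge> 0"
  shows "(\<Sum>(a, b)\<in>edges_in c S. f a) \<le> 12 * (\<Sum>a\<in>S. f a)"
proof -
  have "(\<Sum>(a, b)\<in>edges_in c S. f a) = (\<Sum>a\<in>S. \<Sum>b\<in>{b \<in> S. adjacent c a b}. f a)"
    unfolding edges_in_Sigma using assms(1) by (subst sum.Sigma) auto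
  also have "\<dots> = (\<Sum>a\<in>S. real (card {b \<in> S. adjacent c a b}) * f a)" by simp
  also have "\<dots> \<le> (\<Sum>a\<in>S. 12 * f a)"
    using of_nat_mono[OF degree_in_le, where 'a = real] assms(2) by (intro sum_mono mult_right_mono) simp_all
  finally show ?thesis by (simp add: sum_distrib_left)
qed

lemma card_edges_in_le:
  assumes "finite S"
  shows "real (card (edges_in c S)) \<le> 12 * real (card S)"
  using sum_edges_in_le[OF assms, of "\<lambda>_. 1"] by (simp add: case_prod_beta)

lemma oscillation_le:
  fixes u :: "nat \<Rightarrow> real"
  assumes "cut_connected c W" "finite W" "j \<in> W" "k \<in> W"
  shows "\<bar>u j - u k\<bar> \<le> (\<Sum>(a, b)\<in>edges_in c W. \<bar>u a - u b\<bar>)"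
proof -
  have "\<forall>k\<in>W. \<bar>u j - u k\<bar> \<le> (\<Sum>(a, b)\<in>edges_in c W. \<bar>u a - u b\<bar>)"
  proof (rule cut_connected_grow[OF assms(1-3)])
    show "\<forall>k\<in>{j}. \<bar>u j - u k\<bar> \<le> (\<Sum>(a, b)\<in>edges_in c {j}. \<bar>u a - u b\<bar>)"
      by (simp add: sum_nonneg case_prod_beta)
  next
    fix S a b
    assume S: "S \<subseteq> W" "a \<in> S" "b \<in> W - S" "adjacent c a b"
      and IH: "\<forall>k\<in>S. \<bar>u j - u k\<bar> \<le> (\<Sum>(a, b)\<in>edges_in c S. \<bar>u a - u b\<bar>)"
    let ?f = "\<lambda>(a, b). \<bar>u a - u b\<bar>"
    have fin: "finite S" using S(1) assms(2) finite_subset by blast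
    have notin: "(a, b) \<notin> edges_in c S" using S(3) by (simp add: edges_in_def)
    have "\<bar>u a - u b\<bar> + sum ?f (edges_in c S) = sum ?f (insert (a, b) (edges_in c S))"
      using notin finite_edges_in[OF fin, of c] by simp
    also have "\<dots> \<le> sum ?f (edges_in c (insert b S))"
    proof (rule sum_mono2)
      show "finite (edges_in c (insert b S))" using fin by (simp add: finite_edges_in)
      show "insert (a, b) (edges_in c S) \<subseteq> edges_in c (insert b S)"
        using S(2,4) by (auto simp: edges_in_def)
    qed auto
    finally have le: "\<bar>u a - u b\<bar> + sum ?f (edges_in c S) \<le> sum ?f (edges_in c (insert b S))" .
    show "\<forall>k\<in>insert b S. \<bar>u j - u k\<bar> \<le> sum ?f (edges_in c (insert b S))"
    proof
      fix k assume "k \<in> insert b S"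
      then show "\<bar>u j - u k\<bar> \<le> sum ?f (edges_in c (insert b S))"
      proof
        assume "k = b"
        moreover have "\<bar>u j - u b\<bar> \<le> sum ?f (edges_in c (insert b S))"
          using bspec[OF IH S(2)] le by linarith
        ultimately show ?thesis by simp
      next
        assume "k \<in> S"
        then have "\<bar>u j - u k\<bar> \<le> sum ?f (edges_in c S)" using IH by blast
        then show ?thesis using le abs_ge_zero[of "u a - u b"] by linarith
      qed
    qed
  qed
  then show ?thesis using assms(4) by blast
qed

lemma dist_le_card:
  assumes "cut_connected c W" "finite W" "p \<in> W" "q \<in> W"
  shows "dist (c p) (c q) \<le> real (card W)"
proof -
  have "\<forall>q\<in>W. dist (c p) (c q) \<le> real (card W)"
  proof (rule cut_connected_grow[OF assms(1-3)])
    fix S a b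
    assume S: "S \<subseteq> W" "a \<in> S" "b \<in> W - S" "adjacent c a b"
      and IH: "\<forall>q\<in>S. dist (c p) (c q) \<le> real (card S)"
    have fin: "finite S" using S(1) assms(2) finite_subset by blast
    then have "card (insert b S) = Suc (card S)" using S(3) by simp
    moreover have "dist (c p) (c b) \<le> real (card S) + 1"
      using bspec[OF IH S(2)] edge_length[OF S(4)] dist_triangle[of "c p" "c b" "c a"] by linarith
    moreover have "dist (c p) (c q) \<le> real (card S) + 1" if "q \<in> S" for q
      using bspec[OF IH that] by linarith
    ultimately show "\<forall>q\<in>insert b S. dist (c p) (c q) \<le> real (card (insert b S))"
      by (auto simp: add.commute)
  qed simp
  then show ?thesis using assms(4) by blast
qed

lemma graph_dist_le_card:
  assumes "cut_connected c W" "finite W" "p \<in> W" "q \<in> W"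
  shows "graph_dist c p q \<le> card W"
proof -
  have "\<forall>q\<in>W. \<exists>n\<le>card W. (adjacent c ^^ n) p q"
  proof (rule cut_connected_grow[OF assms(1-3)])
    show "\<forall>q\<in>{p}. \<exists>n\<le>card {p}. (adjacent c ^^ n) p q"
      by (intro ballI exI[of _ 0]) simp
  next
    fix S a b
    assume S: "S \<subseteq> W" "a \<in> S" "b \<in> W - S" "adjacent c a b"
      and IH: "\<forall>q\<in>S. \<exists>n\<le>card S. (adjacent c ^^ n) p q"
    have "finite S" using S(1) assms(2) finite_subset by blast
    then have card: "card (insert b S) = Suc (card S)" using S(3) by simp
    obtain n where "n \<le> card S" "(adjacent c ^^ n) p a" using IH S(2) by blast
    then have "Suc n \<le> Suc (card S)" "(adjacent c ^^ Suc n) p b" using S(4) by auto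
    then show "\<forall>q\<in>insert b S. \<exists>n\<le>card (insert b S). (adjacent c ^^ n) p q"
      unfolding card using IH by (metis insert_iff le_SucI)
  qed
  then obtain n where n: "n \<le> card W" "(adjacent c ^^ n) p q" using assms(4) by blast
  have "graph_dist c p q \<le> n" unfolding graph_dist_def by (rule Least_le) (rule n(2))
  then show ?thesis using n(1) by simp
qed

abbreviation harmonic :: "(nat \<Rightarrow> real) \<Rightarrow> bool" where
  "harmonic u \<equiv> \<forall>x. laplacian c u x = 0"

text \<open>
  Otherwise \<open>u\<close> stays below its maximum over \<open>\<Omega>\<close> at all neighbours outside, so harmonicity spreads the
  set where this maximum is attained to all neighbours; it would be all of the infinite graph.
\<close>

lemma maximum_principle:
  assumes "harmonic u" "finite \<Omega>" "x \<in> \<Omega>"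
  shows "\<exists>i\<in>\<Omega>. \<exists>j. j \<notin> \<Omega> \<and> adjacent c i j \<and> u x \<le> u j"
proof (rule ccontr)
  assume no: "\<not> ?thesis"
  define m where "m = Max (u ` \<Omega>)"
  have m: "\<And>i. i \<in> \<Omega> \<Longrightarrow> u i \<le> m" using assms(2) by (simp add: m_def)
  define S where "S = {i \<in> \<Omega>. u i = m}"
  have "m \<in> u ` \<Omega>" unfolding m_def using assms by (intro Max_in) auto
  then have "S \<noteq> {}" by (auto simp: S_def)
  moreover have "b \<in> S" if a: "a \<in> S" and ab: "adjacent c a b" for a b
  proof -
    have a\<Omega>: "a \<in> \<Omega>" "u a = m" using a by (auto simp: S_def)
    have out: "u y < m" if "adjacent c a y" "y \<notin> \<Omega>" for y
    proof (rule ccontr)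
      assume "\<not> u y < m"
      then have "u x \<le> u y" using m[OF assms(3)] by simp
      then show False using no a\<Omega>(1) that by blast
    qed
    have nonneg: "0 \<le> u a - u y" if "y \<in> {y. adjacent c a y}" for y
      using that m[of y] out[of y] a\<Omega>(2) by (cases "y \<in> \<Omega>") auto
    have "(\<Sum>y | adjacent c a y. u a - u y) = 0"
      using spec[OF assms(1), of a] unfolding laplacian_def by (simp only: sum_subtractf)
    then have "u a - u b = 0"
      using sum_nonneg_eq_0_iff[OF finite_neighbours[OF penny], where f = "\<lambda>y. u a - u y"] nonneg ab by blast
    then show ?thesis using out[OF ab] a\<Omega> by (auto simp: S_def)
  qed
  ultimately have "S = UNIV" using cut_connected_UNIV unfolding cut_connected_def by blast
  moreover have "finite S" using assms(2) by (simp add: S_def)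
  ultimately show False by simp
qed

text \<open>
  Summation by parts: testing harmonicity of \<open>u\<close> against \<open>\<phi>\<^sup>2 * u\<close> leaves only the differences of the
  cutoff function \<open>\<phi>\<close>.
\<close>

lemma energy_eq_cutoff_identity:
  fixes \<phi> u :: "nat \<Rightarrow> real"
  assumes "harmonic u" "finite F" and supp: "\<And>i j. \<phi> i \<noteq> 0 \<Longrightarrow> i \<in> F \<and> (adjacent c i j \<longrightarrow> j \<in> F)"
  shows "energy c F (\<lambda>i. \<phi> i * u i) = (\<Sum>(i, j)\<in>edges_in c F. u i * u j * (\<phi> i - \<phi> j)\<^sup>2)"
proof -
  let ?E = "edges_in c F"
  have zero: "(\<Sum>(i, j)\<in>?E. (\<phi> i)\<^sup>2 * u i * (u i - u j)) = 0"
  proof -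
    have "(\<Sum>(i, j)\<in>?E. (\<phi> i)\<^sup>2 * u i * (u i - u j))
      = (\<Sum>i\<in>F. \<Sum>j\<in>{j \<in> F. adjacent c i j}. (\<phi> i)\<^sup>2 * u i * (u i - u j))"
      unfolding edges_in_Sigma using assms(2) by (subst sum.Sigma) auto
    also have "\<dots> = (\<Sum>i\<in>F. 0)"
    proof (rule sum.cong[OF refl])
      fix i assume "i \<in> F"
      show "(\<Sum>j\<in>{j \<in> F. adjacent c i j}. (\<phi> i)\<^sup>2 * u i * (u i - u j)) = 0"
      proof (cases "\<phi> i = 0")
        case False
        then have "{j \<in> F. adjacent c i j} = {j. adjacent c i j}" using supp by blast
        moreover have "(\<Sum>j | adjacent c i j. u i - u j) = 0"
          using spec[OF assms(1), of i] unfolding laplacian_def by (simp only: sum_subtractf)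
        ultimately show ?thesis by (simp flip: sum_distrib_left)
      qed simp
    qed
    finally show ?thesis by simp
  qed
  have "(\<phi> i * u i - \<phi> j * u j)\<^sup>2
    = (\<phi> i)\<^sup>2 * u i * (u i - u j) + (\<phi> j)\<^sup>2 * u j * (u j - u i) + u i * u j * (\<phi> i - \<phi> j)\<^sup>2" for i j
    by (simp add: power2_eq_square algebra_simps)
  then have "energy c F (\<lambda>i. \<phi> i * u i) = (\<Sum>(i, j)\<in>?E. (\<phi> i)\<^sup>2 * u i * (u i - u j))
     + (\<Sum>(i, j)\<in>?E. (\<phi> j)\<^sup>2 * u j * (u j - u i)) + (\<Sum>(i, j)\<in>?E. u i * u j * (\<phi> i - \<phi> j)\<^sup>2)"
    by (simp add: energy_def case_prod_beta flip: sum.distrib)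
  then show ?thesis
    using zero sum_edges_in_swap[of "\<lambda>i j. (\<phi> i)\<^sup>2 * u i * (u i - u j)" c F] by simp
qed

text \<open>
  The cutoff is 1 on the ball of radius \<open>\<rho>\<close>, vanishes outside the one of radius \<open>2 * \<rho>\<close>, and changes by at
  most \<open>1 / \<rho>\<close> along an edge.  The factor 12 bounds the number of neighbours of a vertex.
\<close>

lemma caccioppoli:
  assumes "harmonic u" "\<rho> > 0"
  shows "energy c {i. dist (c i) p \<le> \<rho>} u
    \<le> 12 / \<rho>\<^sup>2 * (\<Sum>i | dist (c i) p \<le> 2 * \<rho> + 1. (u i)\<^sup>2)"
proof -
  define F where "F = {i. dist (c i) p \<le> 2 * \<rho> + 1}"
  let ?E = "edges_in c F" and ?B = "{i. dist (c i) p \<le> \<rho>}"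
  have fin: "finite F" by (simp add: F_def finite_in_cball[OF penny])
  define \<phi> where "\<phi> i = max 0 (min 1 (2 - dist (c i) p / \<rho>))" for i
  have lip: "\<bar>dist (c i) p - dist (c j) p\<bar> \<le> 1" if "adjacent c i j" for i j
    using edge_length[OF that] dist_triangle[of "c i" p "c j"] dist_triangle[of "c j" p "c i"]
    by (simp add: dist_commute abs_le_iff)
  have supp: "i \<in> F \<and> (adjacent c i j \<longrightarrow> j \<in> F)" if "\<phi> i \<noteq> 0" for i j
  proof -
    have "dist (c i) p \<le> 2 * \<rho>"
      using that assms(2) by (auto simp: \<phi>_def max_def min_def field_simps split: if_splits)
    then show ?thesis using lip[of i j] assms(2) by (auto simp: F_def)
  qed
  have one: "\<phi> i = 1" if "i \<in> ?B" for i
  proof -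
    have "dist (c i) p / \<rho> \<le> 1" using that assms(2) by simp
    then show ?thesis by (simp add: \<phi>_def)
  qed
  have step: "u i * u j * (\<phi> i - \<phi> j)\<^sup>2 \<le> 1 / \<rho>\<^sup>2 * (((u i)\<^sup>2 + (u j)\<^sup>2) / 2)"
    if "adjacent c i j" for i j
  proof -
    have "\<bar>\<phi> i - \<phi> j\<bar> \<le> \<bar>dist (c i) p / \<rho> - dist (c j) p / \<rho>\<bar>"
      unfolding \<phi>_def by (auto simp: max_def min_def)
    also have "\<dots> = \<bar>dist (c i) p - dist (c j) p\<bar> / \<rho>"
      using assms(2) by (simp flip: diff_divide_distrib)
    also have "\<dots> \<le> 1 / \<rho>" using lip[OF that] assms(2) by (intro divide_right_mono) auto
    finally have "(\<phi> i - \<phi> j)\<^sup>2 \<le> (1 / \<rho>)\<^sup>2" using assms(2) by (metis abs_ge_zero power2_abs power_mono)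
    then have p: "(\<phi> i - \<phi> j)\<^sup>2 \<le> 1 / \<rho>\<^sup>2" by (simp add: power_divide)
    have am: "u i * u j \<le> ((u i)\<^sup>2 + (u j)\<^sup>2) / 2"
      using zero_le_power2[of "u i - u j"] by (simp add: power2_eq_square algebra_simps)
    have "u i * u j * (\<phi> i - \<phi> j)\<^sup>2 \<le> ((u i)\<^sup>2 + (u j)\<^sup>2) / 2 * (\<phi> i - \<phi> j)\<^sup>2"
      using am by (intro mult_right_mono) auto
    also have "\<dots> \<le> ((u i)\<^sup>2 + (u j)\<^sup>2) / 2 * (1 / \<rho>\<^sup>2)"
      using p by (intro mult_left_mono) auto
    finally show ?thesis by (simp only: mult.commute)
  qed
  have sub: "edges_in c ?B \<subseteq> ?E" using assms(2) by (auto simp: edges_in_def F_def)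
  have "energy c ?B u = (\<Sum>(i, j)\<in>edges_in c ?B. (\<phi> i * u i - \<phi> j * u j)\<^sup>2)"
    unfolding energy_def by (rule sum.cong) (auto simp: edges_in_def one)
  also have "\<dots> \<le> energy c F (\<lambda>i. \<phi> i * u i)"
    unfolding energy_def using sub fin by (intro sum_mono2) (auto simp: finite_edges_in)
  also have "\<dots> = (\<Sum>(i, j)\<in>?E. u i * u j * (\<phi> i - \<phi> j)\<^sup>2)"
    using supp by (rule energy_eq_cutoff_identity[OF assms(1) fin])
  also have "\<dots> \<le> (\<Sum>(i, j)\<in>?E. 1 / \<rho>\<^sup>2 * (((u i)\<^sup>2 + (u j)\<^sup>2) / 2))"
    using step by (intro sum_mono) (auto simp: edges_in_def)
  also have "\<dots> = 1 / \<rho>\<^sup>2 * (((\<Sum>(i, j)\<in>?E. (u i)\<^sup>2) + (\<Sum>(i, j)\<in>?E. (u j)\<^sup>2)) / 2)"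
    by (simp add: case_prod_beta sum_distrib_left sum_divide_distrib flip: sum.distrib)
  also have "\<dots> = 1 / \<rho>\<^sup>2 * (\<Sum>(i, j)\<in>?E. (u i)\<^sup>2)"
    using sum_edges_in_swap[of "\<lambda>i j. (u i)\<^sup>2" c F] by simp
  also have "\<dots> \<le> 1 / \<rho>\<^sup>2 * (12 * (\<Sum>i\<in>F. (u i)\<^sup>2))"
    by (intro mult_left_mono sum_edges_in_le fin) auto
  finally show ?thesis by (simp add: F_def)
qed

end

section \<open>The mean value inequality\<close>

text \<open>
  Circles whose radii differ by this much have disjoint sets of nearby vertices.
\<close>

definition ring_spacing :: "nat \<Rightarrow> real" where
  "ring_spacing D = 2 * nearby_radius D + 1"

context bounded_penny_graph
begin

abbreviation T :: real where "T \<equiv> ring_spacing D"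

lemma M_ge_4: "M \<ge> 4"
  by (simp add: nearby_radius_def)

lemma T_eq: "T = 2 * M + 1"
  by (simp add: ring_spacing_def)

lemma T_ge_9: "T \<ge> 9"
  using M_ge_4 T_eq by linarith

text \<open>
  The upper bound on the number of vertices is the packing bound for an annulus.  The lower bound holds
  because the chain comes close to two antipodal points of the circle and its edges have length 1.
\<close>

lemma circle_chain:
  assumes "s \<ge> T"
  obtains W where "cut_connected c W" "finite W"
    "\<And>i. i \<in> W \<Longrightarrow> \<bar>dist (c i) p - s\<bar> \<le> M"
    "s \<le> real (card W)" "real (card W) \<le> 4 * T * (2 * s + 1)"
    "\<And>i j. adjacent c i j \<Longrightarrow> edge i j \<inter> sphere p s \<noteq> {} \<Longrightarrow> j \<in> W"
proof -
  have conn: "connected (sphere p s)" by (intro connected_sphere) simp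
  obtain W where W: "cut_connected c W"
    "\<And>i. i \<in> W \<Longrightarrow> \<exists>z\<in>sphere p s. dist (c i) z \<le> M"
    "\<And>z. z \<in> sphere p s \<Longrightarrow> \<exists>i\<in>W. dist (c i) z \<le> M"
    "\<And>i j. adjacent c i j \<Longrightarrow> edge i j \<inter> sphere p s \<noteq> {} \<Longrightarrow> i \<in> W \<and> j \<in> W"
    using coarse_neighbourhood[OF conn] by metis
  have near: "\<bar>dist (c i) p - s\<bar> \<le> M" if "i \<in> W" for i
  proof -
    obtain z where "dist p z = s" "dist (c i) z \<le> M" using W(2)[OF \<open>i \<in> W\<close>] by auto
    moreover have "\<bar>dist (c i) p - dist p z\<bar> \<le> dist (c i) z" by metric
    ultimately show ?thesis by simp
  qed
  let ?A = "{i. s - M \<le> dist (c i) p \<and> dist (c i) p \<le> s + M}"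
  have sub: "W \<subseteq> ?A" using near unfolding abs_le_iff by force
  have A: "finite ?A" "real (card ?A) \<le> 4 * T * (2 * s + 1)"
    using packing[OF penny, of "s - M" "s + M" p] assms M_ge_4 by (auto simp: T_eq algebra_simps)
  have fin: "finite W" using sub A(1) finite_subset by blast
  have upper: "real (card W) \<le> 4 * T * (2 * s + 1)" using card_mono[OF A(1) sub] A(2) by linarith
  have lower: "s \<le> real (card W)"
  proof -
    define e :: "real ^ 2" where "e = axis 1 1"
    have e: "norm e = 1" by (simp add: e_def norm_eq_1 inner_axis_axis)
    define y z where "y = p + s *\<^sub>R e" and "z = p - s *\<^sub>R e"
    have "y \<in> sphere p s" "z \<in> sphere p s"
      using assms e T_ge_9 by (auto simp: dist_norm y_def z_def)
    then obtain i j where ij: "i \<in> W" "j \<in> W" "dist (c i) y \<le> M" "dist (c j) z \<le> M"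
      using W(3) by meson
    have "dist y z = norm ((2 * s) *\<^sub>R e)"
      by (simp add: dist_norm y_def z_def flip: scaleR_add_left)
    then have "dist y z = 2 * s" using assms e T_ge_9 by simp
    moreover have "dist y z \<le> dist (c i) y + dist (c i) (c j) + dist (c j) z" by metric
    ultimately have "2 * s - 2 * M \<le> dist (c i) (c j)" using ij by linarith
    then show ?thesis using dist_le_card[OF W(1) fin ij(1,2)] assms T_eq by linarith
  qed
  show thesis using that[OF W(1) fin near lower upper] W(4) by blast
qed

text \<open>
  Let \<open>j\<close> be a vertex near the circle with \<open>\<bar>u x\<bar> \<le> \<bar>u j\<bar>\<close>, from the maximum principle, and \<open>V\<close> the sum of
  the differences along the chain.  Then \<open>\<bar>u x\<bar> \<le> \<bar>u k\<bar> + V\<close> for every \<open>k\<close> in the chain; averaging the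
  squares over its at least \<open>s\<close> vertices gives the first term, the Cauchy-Schwarz inequality for \<open>V\<close> the
  second.
\<close>

lemma circle_estimate:
  assumes "harmonic u" and s: "s \<ge> T"
  obtains W where "finite W"
    "\<And>i. i \<in> W \<Longrightarrow> \<bar>dist (c i) (c x) - s\<bar> \<le> M"
    "(u x)\<^sup>2 \<le> 2 / s * (\<Sum>i\<in>W. (u i)\<^sup>2) + 96 * T * (2 * s + 1) * energy c W u"
proof -
  obtain W where W: "cut_connected c W" "finite W"
    "\<And>i. i \<in> W \<Longrightarrow> \<bar>dist (c i) (c x) - s\<bar> \<le> M"
    "s \<le> real (card W)" "real (card W) \<le> 4 * T * (2 * s + 1)"
    "\<And>i j. adjacent c i j \<Longrightarrow> edge i j \<inter> sphere (c x) s \<noteq> {} \<Longrightarrow> j \<in> W"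
    using circle_chain[OF s] by metis
  have exit: "\<exists>j\<in>W. v x \<le> v j" if v: "harmonic v" for v
  proof -
    let ?\<Omega> = "{i. dist (c i) (c x) \<le> s} \<inter> {i. c i \<in> ball (c x) s}"
    have "finite ?\<Omega>" using finite_in_cball[OF penny] by blast
    moreover have "x \<in> ?\<Omega>" using s T_ge_9 by auto
    ultimately obtain i j where ij: "i \<in> ?\<Omega>" "j \<notin> ?\<Omega>" "adjacent c i j" "v x \<le> v j"
      using maximum_principle[OF v] by meson
    have "edge i j \<inter> frontier (ball (c x) s) \<noteq> {}"
      using ij(1,2) by (intro connected_Int_frontier) (auto simp: dist_commute)
    moreover have "frontier (ball (c x) s) = sphere (c x) s" using s T_ge_9 by simp
    ultimately show ?thesis using W(6)[OF ij(3)] ij(4) by auto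
  qed
  obtain j where j: "j \<in> W" "\<bar>u x\<bar> \<le> \<bar>u j\<bar>"
  proof (cases "u x \<ge> 0")
    case True
    then show thesis using exit[OF assms(1)] that by fastforce
  next
    case False
    have "harmonic (\<lambda>i. - u i)"
    proof
      fix y
      have "laplacian c (\<lambda>i. - u i) y = - laplacian c u y"
        by (simp add: laplacian_def flip: sum_negf)
      then show "laplacian c (\<lambda>i. - u i) y = 0" using assms(1) by simp
    qed
    then show thesis using exit[of "\<lambda>i. - u i"] that False by fastforce
  qed
  define V where "V = (\<Sum>(a, b)\<in>edges_in c W. \<bar>u a - u b\<bar>)"
  have "V\<^sup>2 \<le> energy c W u * real (card (edges_in c W))"
    unfolding V_def energy_def
    using sum_squared_le_sum_of_squares[of "\<lambda>(a, b). \<bar>u a - u b\<bar>" "edges_in c W"]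
    by (simp add: case_prod_beta)
  also have "\<dots> \<le> energy c W u * (12 * (4 * T * (2 * s + 1)))"
    using card_edges_in_le[OF W(2)] W(5)
    by (intro mult_left_mono) (linarith, simp add: energy_def sum_nonneg case_prod_beta)
  finally have V2: "2 * V\<^sup>2 \<le> 96 * T * (2 * s + 1) * energy c W u"
    by (simp only: mult.commute mult.left_commute mult.assoc)
  have each: "(u x)\<^sup>2 \<le> 2 * (u k)\<^sup>2 + 2 * V\<^sup>2" if "k \<in> W" for k
  proof -
    have "\<bar>u j - u k\<bar> \<le> V" unfolding V_def by (rule oscillation_le[OF W(1,2) j(1) that])
    then have "\<bar>u x\<bar> \<le> \<bar>u k\<bar> + V" using j(2) by linarith
    then have "(u x)\<^sup>2 \<le> (\<bar>u k\<bar> + V)\<^sup>2" by (metis abs_ge_zero power2_abs power_mono)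
    also have "\<dots> \<le> 2 * \<bar>u k\<bar>\<^sup>2 + 2 * V\<^sup>2"
      using zero_le_power2[of "\<bar>u k\<bar> - V"] by (simp add: power2_eq_square algebra_simps)
    finally show ?thesis by simp
  qed
  define A where "A = (\<Sum>i\<in>W. (u i)\<^sup>2)"
  have n: "real (card W) > 0" "s > 0" using W(4) s T_ge_9 by linarith+
  have "real (card W) * (u x)\<^sup>2 \<le> 2 * A + real (card W) * (2 * V\<^sup>2)"
    using sum_mono[of W "\<lambda>_. (u x)\<^sup>2", OF each] by (simp add: sum.distrib sum_distrib_left A_def)
  then have "(u x)\<^sup>2 \<le> 2 * A / real (card W) + 2 * V\<^sup>2"
    using n by (simp add: field_simps)
  also have "2 * A / real (card W) \<le> 2 * A / s"
    using W(4) n by (intro divide_left_mono) (simp_all add: A_def sum_nonneg)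
  also have "2 * A / s = 2 / s * A" by simp
  finally have "(u x)\<^sup>2 \<le> 2 / s * A + 96 * T * (2 * s + 1) * energy c W u" using V2 by linarith
  then show thesis using that[OF W(2,3)] by (simp add: A_def)
qed

text \<open>
  Add the estimates for the \<open>N\<close> circles with radii \<open>n * T\<close>, \<open>N < n \<le> 2 * N\<close>, whose chains are disjoint and lie
  in the ball of radius \<open>3 * N * T\<close>, and bound the energy on this ball by Caccioppoli's inequality.
\<close>

lemma mean_value_inequality_nat:
  assumes "harmonic u" "N \<ge> 1"
  shows "(u x)\<^sup>2 \<le> 642 / (real N)\<^sup>2 * (\<Sum>i | dist (c i) (c x) \<le> 7 * real N * T. (u i)\<^sup>2)"
proof -
  define R where "R = real N * T"
  note T = T_ge_9
  have N: "real N \<ge> 1" using assms(2) by simp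
  have RT: "R \<ge> T" using mult_right_mono[OF N, of T] T by (simp add: R_def)
  define A where "A = (\<Sum>i | dist (c i) (c x) \<le> 7 * real N * T. (u i)\<^sup>2)"
  let ?I = "{N + 1..2 * N}"
  define B where "B = {i. dist (c i) (c x) \<le> 3 * R}"
  have finB: "finite B" by (simp add: B_def finite_in_cball[OF penny])
  have "\<exists>W. finite W \<and> (\<forall>i\<in>W. \<bar>dist (c i) (c x) - real n * T\<bar> \<le> M) \<and>
     (u x)\<^sup>2 \<le> 2 / R * (\<Sum>i\<in>W. (u i)\<^sup>2) + 480 * T * R * energy c W u" if n: "n \<in> ?I" for n
  proof -
    define s where "s = real n * T"
    have s: "R \<le> s" "s \<le> 2 * R"
    proof -
      have "real N \<le> real n" "real n \<le> 2 * real N" using n by auto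
      then have "real N * T \<le> real n * T" "real n * T \<le> 2 * real N * T"
        using T by (intro mult_right_mono; simp)+
      then show "R \<le> s" "s \<le> 2 * R" by (simp_all add: R_def s_def)
    qed
    have "s \<ge> T" using s(1) RT by linarith
    then obtain W where W: "finite W" "\<And>i. i \<in> W \<Longrightarrow> \<bar>dist (c i) (c x) - s\<bar> \<le> M"
      "(u x)\<^sup>2 \<le> 2 / s * (\<Sum>i\<in>W. (u i)\<^sup>2) + 96 * T * (2 * s + 1) * energy c W u"
      by (rule circle_estimate[where x = x, OF assms(1)]) blast
    have "2 / s * (\<Sum>i\<in>W. (u i)\<^sup>2) \<le> 2 / R * (\<Sum>i\<in>W. (u i)\<^sup>2)"
      using s RT T by (intro mult_right_mono divide_left_mono sum_nonneg) auto
    moreover have "96 * T * (2 * s + 1) * energy c W u \<le> 96 * T * (5 * R) * energy c W u"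
      using s RT T by (intro mult_right_mono mult_left_mono) (simp_all add: energy_def sum_nonneg case_prod_beta)
    ultimately have "(u x)\<^sup>2 \<le> 2 / R * (\<Sum>i\<in>W. (u i)\<^sup>2) + 96 * T * (5 * R) * energy c W u"
      using W(3) by linarith
    then have "(u x)\<^sup>2 \<le> 2 / R * (\<Sum>i\<in>W. (u i)\<^sup>2) + 480 * T * R * energy c W u"
      by (simp add: mult.assoc)
    then show ?thesis using W(1,2) by (auto simp: s_def)
  qed
  then obtain W where W: "\<And>n. n \<in> ?I \<Longrightarrow> finite (W n)"
    "\<And>n i. n \<in> ?I \<Longrightarrow> i \<in> W n \<Longrightarrow> \<bar>dist (c i) (c x) - real n * T\<bar> \<le> M"
    "\<And>n. n \<in> ?I \<Longrightarrow> (u x)\<^sup>2 \<le> 2 / R * (\<Sum>i\<in>W n. (u i)\<^sup>2) + 480 * T * R * energy c (W n) u"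
    by metis
  have disj: "m = n" if "m \<in> ?I" "n \<in> ?I" "i \<in> W m" "i \<in> W n" for m n i
  proof -
    have "\<bar>real m * T - real n * T\<bar> \<le> 2 * M" using W(2)[OF that(1,3)] W(2)[OF that(2,4)] by linarith
    then have "\<bar>real m - real n\<bar> * T \<le> 2 * M" using T by (simp add: abs_mult flip: left_diff_distrib)
    then have "\<bar>real m - real n\<bar> * T < 1 * T" using T_eq by linarith
    then have "\<bar>real m - real n\<bar> < 1" using T by (subst (asm) mult_less_cancel_right_pos) auto
    then show ?thesis by linarith
  qed
  have WB: "W n \<subseteq> B" if n: "n \<in> ?I" for n
  proof
    fix i assume i: "i \<in> W n"
    have "real n \<le> 2 * real N" using n by auto
    then have "real n * T \<le> 2 * real N * T" using T by (intro mult_right_mono) auto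
    moreover have "M \<le> R" using RT T_eq M_ge_4 by linarith
    ultimately have "dist (c i) (c x) \<le> 3 * R" using W(2)[OF n i] by (simp add: R_def)
    then show "i \<in> B" by (simp add: B_def)
  qed
  have WB_all: "(\<Union>n\<in>?I. W n) \<subseteq> B" using WB by (rule UN_least)
  have sum_u: "(\<Sum>n\<in>?I. \<Sum>i\<in>W n. (u i)\<^sup>2) \<le> (\<Sum>i\<in>B. (u i)\<^sup>2)"
  proof -
    have "(\<Sum>n\<in>?I. \<Sum>i\<in>W n. (u i)\<^sup>2) = (\<Sum>i\<in>(\<Union>n\<in>?I. W n). (u i)\<^sup>2)"
      using W(1) disj by (intro sum.UNION_disjoint[symmetric]) blast+
    also have "\<dots> \<le> (\<Sum>i\<in>B. (u i)\<^sup>2)" using WB_all finB by (intro sum_mono2) simp_all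
    finally show ?thesis .
  qed
  have sum_e: "(\<Sum>n\<in>?I. energy c (W n) u) \<le> energy c B u"
  proof -
    have "(\<Sum>n\<in>?I. energy c (W n) u)
       = (\<Sum>(a, b)\<in>(\<Union>n\<in>?I. edges_in c (W n)). (u a - u b)\<^sup>2)"
      unfolding energy_def using W(1) disj finite_edges_in
      by (intro sum.UNION_disjoint[symmetric]) (simp_all, auto simp: edges_in_def)
    also have "\<dots> \<le> energy c B u"
      unfolding energy_def
    proof (rule sum_mono2)
      show "(\<Union>n\<in>?I. edges_in c (W n)) \<subseteq> edges_in c B"
        using WB_all unfolding edges_in_def by blast
    qed (use finite_edges_in[OF finB] in auto)
    finally show ?thesis .
  qed
  have A7: "(\<Sum>i | dist (c i) (c x) \<le> r. (u i)\<^sup>2) \<le> A" if "r \<le> 7 * R" for r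
    unfolding A_def using that by (intro sum_mono2 finite_in_cball[OF penny]) (auto simp: R_def)
  have A3: "(\<Sum>i\<in>B. (u i)\<^sup>2) \<le> A" unfolding B_def using RT T by (intro A7) simp
  have A6: "(\<Sum>i | dist (c i) (c x) \<le> 2 * (3 * R) + 1. (u i)\<^sup>2) \<le> A" using RT T by (intro A7) simp
  have "energy c B u \<le> 12 / (3 * R)\<^sup>2 * (\<Sum>i | dist (c i) (c x) \<le> 2 * (3 * R) + 1. (u i)\<^sup>2)"
    unfolding B_def using RT T by (intro caccioppoli[OF assms(1)]) auto
  also have "\<dots> \<le> 12 / (3 * R)\<^sup>2 * A" using A6 by (intro mult_left_mono) auto
  finally have eB: "energy c B u \<le> 12 / (3 * R)\<^sup>2 * A" .
  have "real N * (u x)\<^sup>2 = (\<Sum>n\<in>?I. (u x)\<^sup>2)" by simp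
  also have "\<dots> \<le> (\<Sum>n\<in>?I. 2 / R * (\<Sum>i\<in>W n. (u i)\<^sup>2) + 480 * T * R * energy c (W n) u)"
    using W(3) by (intro sum_mono) auto
  also have "\<dots> = 2 / R * (\<Sum>n\<in>?I. \<Sum>i\<in>W n. (u i)\<^sup>2) + 480 * T * R * (\<Sum>n\<in>?I. energy c (W n) u)"
    by (simp only: sum.distrib sum_distrib_left)
  also have "\<dots> \<le> 2 / R * A + 480 * T * R * (12 / (3 * R)\<^sup>2 * A)"
    using sum_u sum_e A3 eB RT T
    by (intro add_mono mult_left_mono) auto
  also have "\<dots> = (2 / R + 640 * T / R) * A"
    using RT T by (simp add: field_simps power2_eq_square)
  also have "\<dots> \<le> (642 / real N) * A"
  proof (rule mult_right_mono)
    have "2 / R + 640 * T / R = (2 + 640 * T) / R" by (simp add: add_divide_distrib)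
    also have "\<dots> \<le> (642 * T) / R" using RT T by (intro divide_right_mono) auto
    also have "\<dots> = 642 / real N" using T N by (simp add: R_def)
    finally show "2 / R + 640 * T / R \<le> 642 / real N" .
    show "0 \<le> A" unfolding A_def by (intro sum_nonneg) auto
  qed
  finally have "real N * (u x)\<^sup>2 \<le> 642 / real N * A" .
  then have "(u x)\<^sup>2 \<le> 642 / (real N)\<^sup>2 * A" using N by (simp add: field_simps power2_eq_square)
  then show ?thesis by (simp add: A_def)
qed

text \<open>
  The factor is \<open>642 * 14\<^sup>2\<close>: rounding \<open>\<rho> / (7 * T)\<close> down loses at most a factor 2.
\<close>

theorem mean_value_inequality:
  assumes "harmonic u" "\<rho> \<ge> 7 * T"
  shows "(u x)\<^sup>2 \<le> 125832 * T\<^sup>2 / \<rho>\<^sup>2 * (\<Sum>i | dist (c i) (c x) \<le> \<rho>. (u i)\<^sup>2)"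
proof -
  define N where "N = nat \<lfloor>\<rho> / (7 * T)\<rfloor>"
  note T = T_ge_9
  have q: "\<rho> / (7 * T) \<ge> 1" using assms(2) T by (simp add: le_divide_eq)
  then have N: "real N \<le> \<rho> / (7 * T)" "\<rho> / (7 * T) < real N + 1" "N \<ge> 1"
    unfolding N_def by linarith+
  have N7: "7 * real N * T \<le> \<rho>" using N(1) T by (simp add: pos_le_divide_eq mult.commute mult.left_commute)
  have "\<rho> / (7 * T) \<le> 2 * real N" using N(2,3) by simp
  then have N14: "\<rho> / (14 * T) \<le> real N" by simp
  have pos: "\<rho> / (14 * T) > 0" using assms(2) T by (intro divide_pos_pos) linarith+
  have "(u x)\<^sup>2 \<le> 642 / (real N)\<^sup>2 * (\<Sum>i | dist (c i) (c x) \<le> 7 * real N * T. (u i)\<^sup>2)"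
    by (rule mean_value_inequality_nat[OF assms(1) N(3)])
  also have "\<dots> \<le> 642 / (\<rho> / (14 * T))\<^sup>2 * (\<Sum>i | dist (c i) (c x) \<le> \<rho>. (u i)\<^sup>2)"
  proof (rule mult_mono)
    show "642 / (real N)\<^sup>2 \<le> 642 / (\<rho> / (14 * T))\<^sup>2"
      using N14 pos by (intro divide_left_mono power_mono mult_pos_pos zero_less_power) auto
    show "(\<Sum>i | dist (c i) (c x) \<le> 7 * real N * T. (u i)\<^sup>2) \<le> (\<Sum>i | dist (c i) (c x) \<le> \<rho>. (u i)\<^sup>2)"
      using N7 by (intro sum_mono2 finite_in_cball[OF penny]) auto
  qed (auto intro: sum_nonneg)
  also have "642 / (\<rho> / (14 * T))\<^sup>2 = 125832 * T\<^sup>2 / \<rho>\<^sup>2"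
    by (simp add: power_divide power_mult_distrib)
  finally show ?thesis .
qed

end

section \<open>Traces of inner products at increasing scales\<close>

text \<open>
  A positive semidefinite form on all functions; it may be degenerate on a given space if \<open>S\<close> is small.
\<close>

definition inner_on :: "nat set \<Rightarrow> (nat \<Rightarrow> real) \<Rightarrow> (nat \<Rightarrow> real) \<Rightarrow> real" where
  "inner_on S u v = (\<Sum>i\<in>S. u i * v i)"

lemma inner_on_commute: "inner_on S u v = inner_on S v u"
  by (simp add: inner_on_def mult.commute)

lemma inner_on_add_left: "inner_on S (u + v) w = inner_on S u w + inner_on S v w"
  by (simp add: inner_on_def algebra_simps sum.distrib)

lemma inner_on_diff_left: "inner_on S (u - v) w = inner_on S u w - inner_on S v w"
  by (simp add: inner_on_def algebra_simps sum_subtractf)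

lemma inner_on_scale_left: "inner_on S (\<lambda>x. a * u x) w = a * inner_on S u w"
  by (simp add: inner_on_def algebra_simps sum_distrib_left)

lemma inner_on_add_right: "inner_on S w (u + v) = inner_on S w u + inner_on S w v"
  by (simp add: inner_on_def algebra_simps sum.distrib)

lemma inner_on_diff_right: "inner_on S w (u - v) = inner_on S w u - inner_on S w v"
  by (simp add: inner_on_def algebra_simps sum_subtractf)

lemma inner_on_scale_right: "inner_on S w (\<lambda>x. a * u x) = a * inner_on S w u"
  by (simp add: inner_on_def algebra_simps sum_distrib_left)

lemmas inner_on_linear = inner_on_add_left inner_on_diff_left inner_on_scale_left inner_on_add_right inner_on_diff_right inner_on_scale_right

lemma inner_on_self_nonneg: "0 \<le> inner_on S u u"
  by (simp add: inner_on_def sum_nonneg)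

lemma inner_on_self_pos: "finite S \<Longrightarrow> i \<in> S \<Longrightarrow> u i \<noteq> 0 \<Longrightarrow> 0 < inner_on S u u"
  unfolding inner_on_def by (intro sum_pos2[of S i]) (auto simp: zero_less_mult_iff not_less linorder_neq_iff)

lemma inner_on_degenerate:
  assumes "finite S" "inner_on S f f = 0"
  shows "inner_on S w f = 0"
proof -
  have "f i = 0" if "i \<in> S" for i using inner_on_self_pos[OF assms(1) that, of f] assms(2) by force
  then show ?thesis by (simp add: inner_on_def)
qed

text \<open>
  The Gram-Schmidt step.  It also works where the form is degenerate: a vector of length 0 is orthogonal to
  everything, and the quotient by its squared length is 0 by convention.
\<close>

lemma orthogonal_residual_exists:
  assumes "finite B" "finite S"
  shows "\<exists>f. w - f \<in> real_fun_span B \<and> (\<forall>v\<in>real_fun_span B. inner_on S f v = 0)"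
  using assms(1)
proof (induction B arbitrary: w)
  case empty
  show ?case by (intro exI[of _ w]) (auto simp: inner_on_def)
next
  case (insert b B)
  obtain f where f: "b - f \<in> real_fun_span B" "\<And>v. v \<in> real_fun_span B \<Longrightarrow> inner_on S f v = 0"
    using insert.IH by blast
  obtain g where g: "w - g \<in> real_fun_span B" "\<And>v. v \<in> real_fun_span B \<Longrightarrow> inner_on S g v = 0"
    using insert.IH by blast
  define t where "t = inner_on S g f / inner_on S f f"
  define h where "h = g - (\<lambda>x. t * f x)"
  have big: "v \<in> real_fun_span (insert b B)" if "v \<in> real_fun_span B" for v
    using that real_fun.span_mono[of B "insert b B"] by blast
  have b: "b \<in> real_fun_span (insert b B)" by (simp add: real_fun.span_base)
  have "f = b - (b - f)" by simp
  then have "f \<in> real_fun_span (insert b B)"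
    using real_fun.span_diff[OF b big[OF f(1)]] by simp
  then have "(w - g) + (\<lambda>x. t * f x) \<in> real_fun_span (insert b B)"
    by (intro real_fun.span_add big[OF g(1)] real_fun.span_scale)
  then have "w - h \<in> real_fun_span (insert b B)" by (simp add: h_def algebra_simps)
  moreover have "inner_on S h v = 0" if "v \<in> real_fun_span (insert b B)" for v
  proof -
    from that obtain k where k: "v - (\<lambda>x. k * b x) \<in> real_fun_span B"
      unfolding real_fun.span_breakdown_eq by blast
    define v1 where "v1 = (v - (\<lambda>x. k * b x)) + (\<lambda>x. k * (b - f) x)"
    have v1: "v1 \<in> real_fun_span B"
      unfolding v1_def using k f(1) by (intro real_fun.span_add real_fun.span_scale)
    have v: "v = v1 + (\<lambda>x. k * f x)" by (simp add: v1_def fun_eq_iff algebra_simps)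
    have "inner_on S h f = inner_on S g f - t * inner_on S f f" by (simp add: h_def inner_on_diff_left inner_on_scale_left)
    then have hf: "inner_on S h f = 0"
      using inner_on_degenerate[OF assms(2), of f g] by (cases "inner_on S f f = 0") (auto simp: t_def)
    show ?thesis
      unfolding v using hf f(2)[OF v1] g(2)[OF v1] by (simp add: inner_on_linear h_def)
  qed
  ultimately show ?case by blast
qed

lemma residual_minimal:
  assumes "g - f \<in> V" "\<And>v. v \<in> V \<Longrightarrow> inner_on S f v = 0"
  shows "inner_on S f f \<le> inner_on S g g"
proof -
  define h where "h = g - f"
  have g: "g = f + h" by (simp add: h_def)
  have "inner_on S f h = 0" unfolding h_def using assms(1) by (rule assms(2))
  moreover have "inner_on S g g = inner_on S f f + 2 * inner_on S f h + inner_on S h h"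
    unfolding g by (simp add: inner_on_add_left inner_on_add_right inner_on_commute[of S h f])
  ultimately show ?thesis using inner_on_self_nonneg[of S h] by linarith
qed

text \<open>
  If \<open>b\<close> is outside the span of \<open>B\<close>, finitely many values determine which multiple of \<open>b\<close> can occur in a
  combination agreeing with \<open>w\<close>.  With this multiple subtracted from \<open>w\<close>, the set \<open>B\<close> alone is left.
\<close>

lemma span_finite_detection:
  assumes "finite B" "w \<notin> real_fun_span B"
  shows "\<exists>S. finite S \<and> (\<forall>v\<in>real_fun_span B. \<exists>i\<in>S. v i \<noteq> w i)"
  using assms
proof (induction B arbitrary: w)
  case empty
  then have "w \<noteq> 0" by simp
  then obtain i where "w i \<noteq> 0" by (auto simp: fun_eq_iff)
  then show ?case by (intro exI[of _ "{i}"]) auto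
next
  case (insert b B)
  show ?case
  proof (cases "b \<in> real_fun_span B")
    case True
    then have "real_fun_span (insert b B) = real_fun_span B" by (rule real_fun.span_redundant)
    then show ?thesis using insert.IH insert.prems by simp
  next
    case False
    from insert.IH[OF this] obtain S1
      where S1: "finite S1" "\<forall>v\<in>real_fun_span B. \<exists>i\<in>S1. v i \<noteq> b i"
      by (elim exE conjE) (rule that)
    define match where "match t \<longleftrightarrow> (\<exists>v\<in>real_fun_span B. \<forall>i\<in>S1. v i + t * b i = w i)" for t
    have uniq: "s = t" if "match s" "match t" for s t
    proof (rule ccontr)
      assume "s \<noteq> t"
      from that obtain x y where x: "x \<in> real_fun_span B" "\<And>i. i \<in> S1 \<Longrightarrow> x i + s * b i = w i"
        and y: "y \<in> real_fun_span B" "\<And>i. i \<in> S1 \<Longrightarrow> y i + t * b i = w i"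
        unfolding match_def by blast
      have "(\<lambda>i. 1 / (t - s) * (x - y) i) \<in> real_fun_span B"
        using x(1) y(1) by (intro real_fun.span_scale real_fun.span_diff)
      then obtain i where i: "i \<in> S1" "1 / (t - s) * (x - y) i \<noteq> b i" using S1(2) by fast
      have "(x - y) i = (t - s) * b i" using x(2)[OF i(1)] y(2)[OF i(1)] by (simp add: algebra_simps)
      then show False using i(2) \<open>s \<noteq> t\<close> by simp
    qed
    have decompose: "\<exists>t v0. v0 \<in> real_fun_span B \<and> v = v0 + (\<lambda>x. t * b x)"
      if "v \<in> real_fun_span (insert b B)" for v
    proof -
      from that obtain t where "v - (\<lambda>x. t * b x) \<in> real_fun_span B"
        unfolding real_fun.span_breakdown_eq by blast
      then show ?thesis by (intro exI[of _ t] exI[of _ "v - (\<lambda>x. t * b x)"]) simp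
    qed
    show ?thesis
    proof (cases "\<exists>t. match t")
      case False
      have "\<exists>i\<in>S1. v i \<noteq> w i" if v: "v \<in> real_fun_span (insert b B)" for v
      proof -
        obtain t v0 where "v0 \<in> real_fun_span B" "v = v0 + (\<lambda>x. t * b x)" using decompose[OF v] by blast
        then show ?thesis using False unfolding match_def by fastforce
      qed
      then show ?thesis using S1(1) by blast
    next
      case True
      then obtain t where t: "match t" by blast
      define w' where "w' = w - (\<lambda>x. t * b x)"
      have "w' \<notin> real_fun_span B"
        using insert.prems unfolding w'_def real_fun.span_breakdown_eq by blast
      from insert.IH[OF this] obtain S2
        where S2: "finite S2" "\<forall>v\<in>real_fun_span B. \<exists>i\<in>S2. v i \<noteq> w' i"
        by (elim exE conjE) (rule that)
      have "\<exists>i\<in>S1 \<union> S2. v i \<noteq> w i" if v: "v \<in> real_fun_span (insert b B)" for v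
      proof (rule ccontr)
        assume no: "\<not> ?thesis"
        obtain s v0 where v0: "v0 \<in> real_fun_span B" "v = v0 + (\<lambda>x. s * b x)" using decompose[OF v] by blast
        have "match s" unfolding match_def using no v0 by (intro bexI[OF _ v0(1)]) auto
        then have "s = t" using uniq t by blast
        moreover obtain i where "i \<in> S2" "v0 i \<noteq> w' i" using bspec[OF S2(2) v0(1)] by (elim bexE)
        moreover from this have "v i = w i" using no by blast
        ultimately show False using v0(2) by (simp add: w'_def)
      qed
      then show ?thesis using S1(1) S2(1) by (intro exI[of _ "S1 \<union> S2"]) auto
    qed
  qed
qed

lemma eventually_linear_imp_le:
  fixes a b C :: real
  assumes "\<And>J::nat. a * real J - C \<le> b * real J"
  shows "a \<le> b"
proof (rule ccontr)
  assume "\<not> a \<le> b"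
  then obtain J :: nat where "C < real J * (a - b)" using reals_Archimedean3[of "a - b"] by auto
  then show False using assms[of J] by (simp add: algebra_simps)
qed

text \<open>
  The product of the ratios telescopes to at least a constant times \<open>\<Lambda>\<close> to the power \<open>- J\<close>, so their mean is
  asymptotically at least \<open>1 / \<Lambda>\<close>.  The inequality \<open>ln x \<le> x - 1\<close> replaces that between the arithmetic and
  the geometric mean.
\<close>

lemma telescoped_ratio_sum:
  fixes a :: "nat \<Rightarrow> real"
  assumes pos: "\<And>j. a j > 0" and "\<Lambda> > 0" "K > 0" and growth: "\<And>j. a j \<le> K * \<Lambda> ^ j"
  shows "real J - (ln K - ln (a 0)) \<le> \<Lambda> * (\<Sum>j<J. a j / a (Suc j))"
proof -
  have "1 + ln \<Lambda> + (ln (a j) - ln (a (Suc j))) \<le> \<Lambda> * (a j / a (Suc j))" for j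
  proof -
    have "\<Lambda> * (a j / a (Suc j)) > 0" using pos assms(2) by simp
    then have "ln (\<Lambda> * (a j / a (Suc j))) \<le> \<Lambda> * (a j / a (Suc j)) - 1" by (rule ln_le_minus_one)
    moreover have "ln (\<Lambda> * (a j / a (Suc j))) = ln \<Lambda> + (ln (a j) - ln (a (Suc j)))"
      using pos[of j] pos[of "Suc j"] assms(2) by (simp add: ln_mult ln_div)
    ultimately show ?thesis by linarith
  qed
  then have "(\<Sum>j<J. 1 + ln \<Lambda> + (ln (a j) - ln (a (Suc j)))) \<le> (\<Sum>j<J. \<Lambda> * (a j / a (Suc j)))"
    by (intro sum_mono) blast
  moreover have "(\<Sum>j<J. 1 + ln \<Lambda> + (ln (a j) - ln (a (Suc j)))) = real J * (1 + ln \<Lambda>) + (ln (a 0) - ln (a J))"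
    using sum_lessThan_telescope'[of "\<lambda>j. ln (a j)" J] by (simp add: sum.distrib)
  moreover have "ln (a J) \<le> ln K + real J * ln \<Lambda>"
  proof -
    have "ln (a J) \<le> ln (K * \<Lambda> ^ J)" using pos growth ln_mono by blast
    also have "\<dots> = ln K + real J * ln \<Lambda>" using assms(2,3) by (simp add: ln_mult ln_realpow)
    finally show ?thesis .
  qed
  ultimately show ?thesis by (simp add: algebra_simps sum_distrib_left)
qed

text \<open>
  Let \<open>a n j\<close> be the squared distance, at scale \<open>j\<close>, from \<open>u n\<close> to the span of its predecessors.  It is
  attained by a residual \<open>f n j\<close>.  The residuals at scale \<open>j + 1\<close> are orthogonal, and normalising them gives an
  orthonormal family \<open>e\<close>.  Since \<open>f n (j + 1)\<close> competes in the minimum defining \<open>a n j\<close>, the ratio of \<open>a n j\<close>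
  to \<open>a n (j + 1)\<close> is at most the squared length of \<open>e n\<close> at scale \<open>j\<close>.  So these ratios sum to at most \<open>Q\<close>
  over \<open>n\<close>, while over \<open>j\<close> their mean is at least \<open>1 / \<Lambda>\<close> asymptotically.  Distances to spans of predecessors
  take the place of Gram determinants.
\<close>

lemma dimension_bound_from_traces:
  fixes u :: "nat \<Rightarrow> nat \<Rightarrow> real" and S :: "nat \<Rightarrow> nat set"
  assumes fin: "\<And>j. finite (S j)" and mono: "\<And>j. S j \<subseteq> S (Suc j)" and exhaust: "\<And>i. \<exists>j. i \<in> S j"
    and indep: "\<And>n. n < m \<Longrightarrow> u n \<notin> real_fun_span (u ` {..<n})"
    and growth: "\<And>n. n < m \<Longrightarrow> \<exists>K>0. \<forall>j. inner_on (S j) (u n) (u n) \<le> K * \<Lambda> ^ j"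
    and "\<Lambda> > 0"
    and trace: "\<And>j e. \<lbrakk>\<And>n. n < m \<Longrightarrow> e n \<in> real_fun_span (u ` {..<m});
        \<And>a b. \<lbrakk>a < m; b < m\<rbrakk> \<Longrightarrow> inner_on (S (Suc j)) (e a) (e b) = (if a = b then 1 else 0)\<rbrakk>
      \<Longrightarrow> (\<Sum>n<m. inner_on (S j) (e n) (e n)) \<le> Q"
  shows "real m \<le> \<Lambda> * Q"
proof -
  define V where "V n = real_fun_span (u ` {..<n})" for n
  have Vmono: "V a \<subseteq> V b" if "a \<le> b" for a b
    unfolding V_def using that by (intro real_fun.span_mono image_mono) auto
  have Smono: "S a \<subseteq> S b" if "a \<le> b" for a b
    using lift_Suc_mono_le[of S, OF mono that] .
  have "\<exists>j. F \<subseteq> S j" if "finite F" for F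
    using that
  proof induction
    case (insert i F)
    obtain j where "F \<subseteq> S j" using insert.IH by (rule exE)
    moreover obtain k where "i \<in> S k" using exhaust[of i] by (rule exE)
    ultimately have "insert i F \<subseteq> S (max j k)"
      using subsetD[OF Smono[of k "max j k"], of i] subset_trans[OF _ Smono[of j "max j k"], of F] by simp
    then show ?case by (rule exI)
  qed simp
  then have "\<exists>j. \<forall>v\<in>V n. \<exists>i\<in>S j. v i \<noteq> u n i" if "n < m" for n
    using span_finite_detection[OF _ indep[OF that]] unfolding V_def
    by (metis finite_imageI finite_lessThan subsetD)
  then obtain js where js: "\<And>n v. n < m \<Longrightarrow> v \<in> V n \<Longrightarrow> \<exists>i\<in>S (js n). v i \<noteq> u n i" by metis
  \<comment> \<open>from scale \<open>j0\<close> on, all residuals are nonzero\<close>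
  define j0 where "j0 = (\<Sum>n<m. js n)"
  have j0: "js n \<le> j0" if "n < m" for n
    unfolding j0_def using that by (intro member_le_sum) auto
  define S' where "S' j = S (j0 + j)" for j
  have "\<exists>f. u n - f \<in> V n \<and> (\<forall>v\<in>V n. inner_on (S' j) f v = 0)" for n j
    unfolding V_def S'_def by (intro orthogonal_residual_exists fin) auto
  then obtain f where f: "\<And>n j. u n - f n j \<in> V n" "\<And>n j v. v \<in> V n \<Longrightarrow> inner_on (S' j) (f n j) v = 0"
    by metis
  define a where "a n j = inner_on (S' j) (f n j) (f n j)" for n j
  have pos: "a n j > 0" if n: "n < m" for n j
  proof -
    obtain i where i: "i \<in> S (js n)" "(u n - f n j) i \<noteq> u n i" using js[OF n f(1)] by blast
    then have "i \<in> S' j" using Smono[of "js n" "j0 + j"] j0[OF n] unfolding S'_def by auto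
    then show ?thesis unfolding a_def S'_def using i(2) by (intro inner_on_self_pos[of _ i] fin) auto
  qed
  have le_u: "a n j \<le> inner_on (S' j) (u n) (u n)" for n j
    unfolding a_def using f by (intro residual_minimal[of _ _ "V n"])
  have le_next: "a n j \<le> inner_on (S' j) (f n (Suc j)) (f n (Suc j))" for n j
    unfolding a_def
  proof (rule residual_minimal[of _ _ "V n"])
    have "f n (Suc j) - f n j = (u n - f n j) - (u n - f n (Suc j))" by simp
    also have "\<dots> \<in> V n" unfolding V_def by (intro real_fun.span_diff f(1)[unfolded V_def])
    finally show "f n (Suc j) - f n j \<in> V n" .
  qed (use f in auto)
  have fV: "f n j \<in> V (Suc n)" for n j
  proof -
    have "u n \<in> V (Suc n)" unfolding V_def by (intro real_fun.span_base) auto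
    moreover have "u n - f n j \<in> V (Suc n)" using f(1) Vmono[of n "Suc n"] by auto
    ultimately have "u n - (u n - f n j) \<in> V (Suc n)" unfolding V_def by (rule real_fun.span_diff)
    then show ?thesis by simp
  qed
  have orth: "inner_on (S' j) (f n j) (f k j) = 0" if "k < n" for n k j
    using f(2) fV Vmono[of "Suc k" n] that by (meson Suc_leI subsetD)
  have ratio: "(\<Sum>n<m. a n j / a n (Suc j)) \<le> Q" for j
  proof -
    define e where "e n = (\<lambda>x. 1 / sqrt (a n (Suc j)) * f n (Suc j) x)" for n
    have "(\<Sum>n<m. inner_on (S (j0 + j)) (e n) (e n)) \<le> Q"
    proof (rule trace)
      show "e n \<in> real_fun_span (u ` {..<m})" if "n < m" for n
        unfolding e_def using fV[of n "Suc j"] Vmono[of "Suc n" m] that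
        by (intro real_fun.span_scale) (auto simp: V_def)
      show "inner_on (S (Suc (j0 + j))) (e k) (e l) = (if k = l then 1 else 0)" if "k < m" "l < m" for k l
      proof -
        have e: "inner_on (S' (Suc j)) (e k) (e l)
          = 1 / sqrt (a k (Suc j)) * (1 / sqrt (a l (Suc j)) * inner_on (S' (Suc j)) (f k (Suc j)) (f l (Suc j)))"
          unfolding e_def inner_on_scale_left inner_on_scale_right ..
        have "inner_on (S' (Suc j)) (e k) (e l) = (if k = l then 1 else 0)"
        proof (cases "k = l")
          case True
          then show ?thesis
            using pos[OF that(1), of "Suc j"] unfolding e by (simp flip: a_def)
        next
          case False
          then have "inner_on (S' (Suc j)) (f k (Suc j)) (f l (Suc j)) = 0"
            using orth[of k l "Suc j"] orth[of l k "Suc j"] inner_on_commute by (metis linorder_neqE_nat)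
          then show ?thesis using False unfolding e by simp
        qed
        then show ?thesis by (simp add: S'_def)
      qed
    qed
    moreover have "(\<Sum>n<m. a n j / a n (Suc j)) \<le> (\<Sum>n<m. inner_on (S (j0 + j)) (e n) (e n))"
    proof (rule sum_mono)
      fix n assume "n \<in> {..<m}"
      then have p: "a n (Suc j) > 0" using pos by simp
      have "inner_on (S' j) (e n) (e n) = inner_on (S' j) (f n (Suc j)) (f n (Suc j)) / a n (Suc j)"
        unfolding e_def inner_on_scale_left inner_on_scale_right using p by (simp add: field_simps)
      moreover have "a n j / a n (Suc j) \<le> inner_on (S' j) (f n (Suc j)) (f n (Suc j)) / a n (Suc j)"
        using le_next p by (intro divide_right_mono) auto
      ultimately show "a n j / a n (Suc j) \<le> inner_on (S (j0 + j)) (e n) (e n)" by (simp add: S'_def)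
    qed
    ultimately show ?thesis by linarith
  qed
  have "\<exists>C. \<forall>J. real J - C \<le> \<Lambda> * (\<Sum>j<J. a n j / a n (Suc j))" if n: "n < m" for n
  proof -
    obtain K where K: "K > 0" "\<And>j. inner_on (S j) (u n) (u n) \<le> K * \<Lambda> ^ j" using growth[OF n] by blast
    have "real J - (ln (K * \<Lambda> ^ j0) - ln (a n 0)) \<le> \<Lambda> * (\<Sum>j<J. a n j / a n (Suc j))" for J
    proof (rule telescoped_ratio_sum)
      show "K * \<Lambda> ^ j0 > 0" using K(1) assms(6) by simp
      show "a n j \<le> K * \<Lambda> ^ j0 * \<Lambda> ^ j" for j
        using le_u[of n j] K(2)[of "j0 + j"] by (simp add: S'_def power_add mult.assoc)
    qed (use pos n assms(6) in auto)
    then show ?thesis by blast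
  qed
  then obtain C where C: "\<And>n J. n < m \<Longrightarrow> real J - C n \<le> \<Lambda> * (\<Sum>j<J. a n j / a n (Suc j))" by metis
  have "real m * real J - (\<Sum>n<m. C n) \<le> \<Lambda> * Q * real J" for J
  proof -
    have "real m * real J - (\<Sum>n<m. C n) = (\<Sum>n<m. real J - C n)" by (simp add: sum_subtractf)
    also have "\<dots> \<le> (\<Sum>n<m. \<Lambda> * (\<Sum>j<J. a n j / a n (Suc j)))" using C by (intro sum_mono) auto
    also have "\<dots> = \<Lambda> * (\<Sum>j<J. \<Sum>n<m. a n j / a n (Suc j))"
      by (subst sum.swap) (simp add: sum_distrib_left)
    also have "\<dots> \<le> \<Lambda> * (\<Sum>j<J. Q)" using ratio assms(6) by (intro mult_left_mono sum_mono) auto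
    finally show ?thesis by (simp add: algebra_simps)
  qed
  then show ?thesis by (rule eventually_linear_imp_le)
qed

section \<open>The dimension bound\<close>

lemma sum_inverse_squares_le:
  assumes "N \<ge> 2"
  shows "(\<Sum>n = N..<N + k. 1 / (real n)\<^sup>2) \<le> 1 / (real N - 1) - 1 / (real (N + k) - 1)"
proof (induction k)
  case (Suc k)
  define x where "x = real (N + k)"
  have x: "x \<ge> 2" using assms by (simp add: x_def)
  have "1 / x\<^sup>2 \<le> 1 / (x - 1) - 1 / x"
    using x by (simp add: field_simps power2_eq_square)
  then show ?case using Suc by (simp add: x_def)
qed simp

context bounded_penny_graph
begin

lemma laplacian_sum:
  "laplacian c (\<lambda>y. \<Sum>n\<in>A. a n * u n y) x = (\<Sum>n\<in>A. a n * laplacian c (u n) x)"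
proof -
  have "laplacian c (\<lambda>y. \<Sum>n\<in>A. a n * u n y) x
      = (\<Sum>y | adjacent c x y. \<Sum>n\<in>A. a n * (u n y - u n x))"
    by (simp add: laplacian_def right_diff_distrib sum_subtractf)
  also have "\<dots> = (\<Sum>n\<in>A. \<Sum>y | adjacent c x y. a n * (u n y - u n x))" by (rule sum.swap)
  finally show ?thesis by (simp add: laplacian_def sum_distrib_left)
qed

text \<open>
  The harmonic function \<open>w = (\<Sum>n<m. e n x * e n)\<close> has the value \<open>s\<close> at \<open>x\<close>, where \<open>s\<close> is the left-hand side,
  and squared norm \<open>s\<close> on the ball of radius \<open>R'\<close>.  The mean value inequality for it bounds \<open>s\<^sup>2\<close> by a
  multiple of \<open>s\<close>.
\<close>

lemma pointwise_trace_le: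
  fixes e :: "nat \<Rightarrow> nat \<Rightarrow> real"
  assumes harm: "\<And>n. n < m \<Longrightarrow> harmonic (e n)"
    and orth: "\<And>a b. a < m \<Longrightarrow> b < m \<Longrightarrow>
      inner_on {i. dist (c i) p \<le> R'} (e a) (e b) = (if a = b then 1 else 0)"
    and \<rho>: "R' - dist (c x) p \<ge> 7 * T"
  shows "(\<Sum>n<m. (e n x)\<^sup>2) \<le> 125832 * T\<^sup>2 / (R' - dist (c x) p)\<^sup>2"
proof -
  let ?B = "{i. dist (c i) p \<le> R'}" and ?K = "125832 * T\<^sup>2 / (R' - dist (c x) p)\<^sup>2"
  define w where "w y = (\<Sum>n<m. e n x * e n y)" for y
  define s where "s = (\<Sum>n<m. (e n x)\<^sup>2)"
  have finB: "finite ?B" by (rule finite_in_cball[OF penny])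
  have "w x = s" by (simp add: w_def s_def power2_eq_square)
  have harm_w: "harmonic w"
    unfolding w_def laplacian_sum using harm by simp
  have "(\<Sum>y\<in>?B. (w y)\<^sup>2) = (\<Sum>y\<in>?B. \<Sum>a<m. \<Sum>b<m. e a x * e b x * (e a y * e b y))"
    by (simp add: w_def power2_eq_square sum_product algebra_simps)
  also have "\<dots> = (\<Sum>a<m. \<Sum>y\<in>?B. \<Sum>b<m. e a x * e b x * (e a y * e b y))" by (rule sum.swap)
  also have "\<dots> = (\<Sum>a<m. \<Sum>b<m. \<Sum>y\<in>?B. e a x * e b x * (e a y * e b y))"
    by (intro sum.cong refl sum.swap)
  also have "\<dots> = (\<Sum>a<m. \<Sum>b<m. e a x * e b x * inner_on ?B (e a) (e b))"
    by (simp only: inner_on_def sum_distrib_left)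
  also have "\<dots> = (\<Sum>a<m. \<Sum>b<m. if a = b then (e a x)\<^sup>2 else 0)"
    using orth by (intro sum.cong refl) (auto simp: power2_eq_square)
  also have "\<dots> = s" by (simp add: s_def)
  finally have w2: "(\<Sum>y\<in>?B. (w y)\<^sup>2) = s" .
  have "s\<^sup>2 \<le> ?K * (\<Sum>i | dist (c i) (c x) \<le> R' - dist (c x) p. (w i)\<^sup>2)"
    using mean_value_inequality[OF harm_w \<rho>, of x] \<open>w x = s\<close> by simp
  also have "\<dots> \<le> ?K * (\<Sum>y\<in>?B. (w y)\<^sup>2)"
  proof (intro mult_left_mono sum_mono2 finB)
    show "{i. dist (c i) (c x) \<le> R' - dist (c x) p} \<subseteq> ?B"
    proof
      fix i assume "i \<in> {i. dist (c i) (c x) \<le> R' - dist (c x) p}"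
      then show "i \<in> ?B" using dist_triangle[of "c i" p "c x"] by simp
    qed
  qed auto
  finally have "s * s \<le> ?K * s" using w2 by (simp add: power2_eq_square)
  moreover have "s \<ge> 0" unfolding s_def by (intro sum_nonneg) simp
  moreover have "?K \<ge> 0" by simp
  ultimately have "s \<le> ?K" by (metis mult_le_cancel_right order_le_less)
  then show ?thesis unfolding s_def .
qed

lemma card_shell_le:
  assumes "n \<ge> 1" "R' \<ge> 1"
  shows "real (card {i. n \<le> R' - dist (c i) p \<and> R' - dist (c i) p \<le> n + 1}) \<le> 24 * R'"
proof (cases "n \<le> R'")
  case False
  have "\<not> n \<le> R' - dist (c i) p" for i
    using False zero_le_dist[of "c i" p] by linarith
  then have "{i. n \<le> R' - dist (c i) p \<and> R' - dist (c i) p \<le> n + 1} = {}" by blast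
  then show ?thesis using assms by (simp only: card.empty)
next
  case True
  define a b where "a = max 0 (R' - n - 1)" and "b = R' - n"
  have ab: "0 \<le> a" "a \<le> b" "b - a \<le> 1" "a + b + 1 \<le> 3 * R'"
    using True assms by (auto simp: a_def b_def)
  have "card {i. n \<le> R' - dist (c i) p \<and> R' - dist (c i) p \<le> n + 1}
      \<le> card {i. a \<le> dist (c i) p \<and> dist (c i) p \<le> b}"
    by (intro card_mono packing(1)[OF penny ab(1,2)]) (auto simp: a_def b_def)
  then have "real (card {i. n \<le> R' - dist (c i) p \<and> R' - dist (c i) p \<le> n + 1})
      \<le> 4 * (b - a + 1) * (a + b + 1)"
    using packing(2)[OF penny ab(1,2), of p] by linarith
  also have "\<dots> \<le> (4 * 2) * (3 * R')"
    using ab assms by (intro mult_mono) auto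
  finally show ?thesis by simp
qed

text \<open>
  Sort the vertices by the integer part \<open>n\<close> of their distance to the larger circle: there are at most
  \<open>24 * (R + \<delta>)\<close> of them for each \<open>n\<close>, and the sum of \<open>1 / n\<^sup>2\<close> from the
  integer part of \<open>\<delta>\<close> on is at most \<open>2 / \<delta>\<close>.
\<close>

lemma shell_sum_le:
  assumes "\<delta> \<ge> 4" "R \<ge> 1"
  shows "(\<Sum>i | dist (c i) p \<le> R. 1 / (R + \<delta> - dist (c i) p)\<^sup>2) \<le> 48 * (R + \<delta>) / \<delta>"
proof -
  define R' where "R' = R + \<delta>"
  define g where "g i = nat \<lfloor>R' - dist (c i) p\<rfloor>" for i
  define N where "N = nat \<lfloor>\<delta>\<rfloor>"
  let ?B = "{i. dist (c i) p \<le> R}"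
  have finB: "finite ?B" by (rule finite_in_cball[OF penny])
  have N: "real N \<le> \<delta>" "\<delta> < real N + 1" "N \<ge> 2" unfolding N_def using assms(1) by linarith+
  have g: "real (g i) \<le> R' - dist (c i) p" "R' - dist (c i) p \<le> real (g i) + 1" "g i \<ge> N"
    if "i \<in> ?B" for i
  proof -
    have "R' - dist (c i) p \<ge> \<delta>" using that by (simp add: R'_def)
    then show "real (g i) \<le> R' - dist (c i) p" "R' - dist (c i) p \<le> real (g i) + 1" "g i \<ge> N"
      unfolding g_def N_def using assms(1) by linarith+
  qed
  define L where "L = Max (insert 0 (g ` ?B))"
  have gL: "g ` ?B \<subseteq> {N..<N + Suc L}"
  proof
    fix n assume n: "n \<in> g ` ?B"
    then have "n \<le> L" unfolding L_def using finB by (intro Max_ge) auto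
    moreover have "N \<le> n" using n g(3) by blast
    ultimately show "n \<in> {N..<N + Suc L}" by simp
  qed
  have "(\<Sum>i\<in>?B. 1 / (R' - dist (c i) p)\<^sup>2)
      = (\<Sum>n\<in>g ` ?B. \<Sum>i\<in>{i\<in>?B. g i = n}. 1 / (R' - dist (c i) p)\<^sup>2)"
    by (rule sum.image_gen[OF finB])
  also have "\<dots> \<le> (\<Sum>n\<in>g ` ?B. 24 * R' * (1 / (real n)\<^sup>2))"
  proof (rule sum_mono)
    fix n assume "n \<in> g ` ?B"
    then have n: "n \<ge> 2" using gL N(3) by auto
    let ?C = "{i. real n \<le> R' - dist (c i) p \<and> R' - dist (c i) p \<le> real n + 1}"
    have finC: "finite ?C"
      by (rule finite_subset[OF _ finite_in_cball[OF penny, of p "R' - real n"]]) auto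
    have sub: "{i\<in>?B. g i = n} \<subseteq> ?C" using g by auto
    have "(\<Sum>i\<in>{i\<in>?B. g i = n}. 1 / (R' - dist (c i) p)\<^sup>2) \<le> (\<Sum>i\<in>{i\<in>?B. g i = n}. 1 / (real n)\<^sup>2)"
    proof (rule sum_mono)
      fix i assume "i \<in> {i\<in>?B. g i = n}"
      then have "real n \<le> R' - dist (c i) p" using g by auto
      then show "1 / (R' - dist (c i) p)\<^sup>2 \<le> 1 / (real n)\<^sup>2"
        using n by (intro divide_left_mono power_mono mult_pos_pos zero_less_power) auto
    qed
    also have "\<dots> = real (card {i\<in>?B. g i = n}) * (1 / (real n)\<^sup>2)" by simp
    also have "\<dots> \<le> (24 * R') * (1 / (real n)\<^sup>2)"
    proof (rule mult_right_mono)
      have "real (card {i\<in>?B. g i = n}) \<le> real (card ?C)" using card_mono[OF finC sub] by simp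
      also have "\<dots> \<le> 24 * R'" using n assms by (intro card_shell_le) (auto simp: R'_def)
      finally show "real (card {i\<in>?B. g i = n}) \<le> 24 * R'" .
    qed simp
    finally show "(\<Sum>i\<in>{i\<in>?B. g i = n}. 1 / (R' - dist (c i) p)\<^sup>2) \<le> 24 * R' * (1 / (real n)\<^sup>2)" .
  qed
  also have "\<dots> \<le> (\<Sum>n = N..<N + Suc L. 24 * R' * (1 / (real n)\<^sup>2))"
    using gL assms by (intro sum_mono2) (auto simp: R'_def)
  also have "\<dots> = 24 * R' * (\<Sum>n = N..<N + Suc L. 1 / (real n)\<^sup>2)" by (rule sum_distrib_left[symmetric])
  also have "\<dots> \<le> 24 * R' * (2 / \<delta>)"
  proof (rule mult_left_mono)
    have "(\<Sum>n = N..<N + Suc L. 1 / (real n)\<^sup>2) \<le> 1 / (real N - 1) - 1 / (real (N + Suc L) - 1)"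
      by (rule sum_inverse_squares_le[OF N(3)])
    also have "\<dots> \<le> 1 / (real N - 1)" using N(3) by simp
    also have "\<dots> \<le> 1 / (\<delta> / 2)" using N assms(1) by (intro divide_left_mono mult_pos_pos) auto
    finally show "(\<Sum>n = N..<N + Suc L. 1 / (real n)\<^sup>2) \<le> 2 / \<delta>" by simp
  qed (use assms in \<open>simp add: R'_def\<close>)
  finally show ?thesis by (simp add: R'_def)
qed

lemma trace_le:
  fixes e :: "nat \<Rightarrow> nat \<Rightarrow> real"
  assumes harm: "\<And>n. n < m \<Longrightarrow> harmonic (e n)"
    and orth: "\<And>a b. a < m \<Longrightarrow> b < m \<Longrightarrow>
      inner_on {i. dist (c i) p \<le> R + \<delta>} (e a) (e b) = (if a = b then 1 else 0)"
    and \<delta>: "\<delta> \<ge> 7 * T" and R: "R \<ge> 1"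
  shows "(\<Sum>n<m. inner_on {i. dist (c i) p \<le> R} (e n) (e n)) \<le> 125832 * T\<^sup>2 * (48 * (R + \<delta>) / \<delta>)"
proof -
  let ?B = "{i. dist (c i) p \<le> R}"
  have "(\<Sum>n<m. inner_on ?B (e n) (e n)) = (\<Sum>i\<in>?B. \<Sum>n<m. (e n i)\<^sup>2)"
    unfolding inner_on_def by (subst sum.swap) (simp add: power2_eq_square)
  also have "\<dots> \<le> (\<Sum>i\<in>?B. 125832 * T\<^sup>2 * (1 / (R + \<delta> - dist (c i) p)\<^sup>2))"
  proof (rule sum_mono)
    fix i assume "i \<in> ?B"
    then have "R + \<delta> - dist (c i) p \<ge> 7 * T" using \<delta> by simp
    from pointwise_trace_le[OF harm orth this]
    show "(\<Sum>n<m. (e n i)\<^sup>2) \<le> 125832 * T\<^sup>2 * (1 / (R + \<delta> - dist (c i) p)\<^sup>2)" by simp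
  qed
  also have "\<dots> = 125832 * T\<^sup>2 * (\<Sum>i\<in>?B. 1 / (R + \<delta> - dist (c i) p)\<^sup>2)"
    by (rule sum_distrib_left[symmetric])
  also have "\<dots> \<le> 125832 * T\<^sup>2 * (48 * (R + \<delta>) / \<delta>)"
    using \<delta> T_ge_9 R by (intro mult_left_mono shell_sum_le) auto
  finally show ?thesis .
qed

text \<open>
  The vertices near the segment from \<open>c x\<close> to \<open>c y\<close> form a connected set containing \<open>x\<close> and \<open>y\<close>; its size is
  estimated by packing in a ball, which suffices although it is wasteful.
\<close>

lemma graph_dist_le_square:
  "real (graph_dist c x y) \<le> 4 * (dist (c x) (c y) + M + 1)\<^sup>2"
proof -
  define L where "L = dist (c x) (c y)"
  obtain W where W: "cut_connected c W"
    "\<And>i. i \<in> W \<Longrightarrow> \<exists>z\<in>closed_segment (c x) (c y). dist (c i) z \<le> M"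
    "\<And>i j. adjacent c i j \<Longrightarrow> edge i j \<inter> closed_segment (c x) (c y) \<noteq> {} \<Longrightarrow> i \<in> W \<and> j \<in> W"
    using coarse_neighbourhood[OF connected_segment(1), of "c x" "c y"] by metis
  have mem: "v \<in> W" if "v = x \<or> v = y" for v
  proof -
    obtain j where "adjacent c v j" using has_neighbour by blast
    moreover have "c v \<in> edge v j \<inter> closed_segment (c x) (c y)" using that by auto
    ultimately show ?thesis using W(3) by blast
  qed
  let ?A = "{i. 0 \<le> dist (c i) (c y) \<and> dist (c i) (c y) \<le> L + M}"
  have L: "0 \<le> L + M" using M_ge_4 zero_le_dist[of "c x" "c y"] unfolding L_def by linarith
  have sub: "W \<subseteq> ?A"
  proof
    fix i assume "i \<in> W"
    then obtain z where z: "z \<in> closed_segment (c x) (c y)" "dist (c i) z \<le> M" using W(2) by blast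
    have "dist z (c y) \<le> L"
      using dist_endpoint_le[of z "c y" "c x"] z(1)
      by (simp add: L_def closed_segment_commute dist_commute)
    then show "i \<in> ?A" using z(2) dist_triangle[of "c i" "c y" z] by simp
  qed
  note A = packing[OF penny order_refl L, of "c y"]
  have "graph_dist c x y \<le> card W"
    by (rule graph_dist_le_card[OF W(1) finite_subset[OF sub A(1)]]) (simp_all add: mem)
  also have "\<dots> \<le> card ?A" by (rule card_mono[OF A(1) sub])
  finally have "real (graph_dist c x y) \<le> 4 * (L + M - 0 + 1) * (0 + (L + M) + 1)"
    using A(2) by linarith
  then show ?thesis by (simp only: L_def power2_eq_square mult.assoc diff_zero add_0_left)
qed

lemma l2_growth:
  assumes u: "u \<in> polynomial_growth_harmonic c x0 k" and k: "k \<ge> 1"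
  shows "\<exists>K>0. \<forall>R\<ge>1. inner_on {i. dist (c i) (c x0) \<le> R} u u \<le> K * R powr (4 * k + 2)"
proof -
  obtain C where C: "\<And>x. \<bar>u x\<bar> \<le> C * (1 + real (graph_dist c x x0)) powr k"
    using u by (auto simp: polynomial_growth_harmonic_def)
  have "C \<ge> 0"
  proof (rule ccontr)
    assume "\<not> C \<ge> 0"
    then have "C * (1 + real (graph_dist c 0 x0)) powr k < 0" by (intro mult_neg_pos) auto
    then show False using C[of 0] by linarith
  qed
  define A where "A = 5 * (M + 2)\<^sup>2"
  define K where "K = 16 * (C * A powr k)\<^sup>2 + 1"
  have A: "A > 0" using M_ge_4 by (simp add: A_def)
  have "inner_on {i. dist (c i) (c x0) \<le> R} u u \<le> K * R powr (4 * k + 2)" if R: "R \<ge> 1" for R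
  proof -
    let ?B = "{i. 0 \<le> dist (c i) (c x0) \<and> dist (c i) (c x0) \<le> R}"
    have each: "u i * u i \<le> (C * A powr k)\<^sup>2 * R powr (4 * k)" if i: "i \<in> ?B" for i
    proof -
      have M: "M * 1 \<le> M * R" using R M_ge_4 by (intro mult_left_mono) auto
      have "dist (c i) (c x0) + M + 1 \<le> (M + 2) * R"
        using i R M by (simp add: algebra_simps)
      then have "(dist (c i) (c x0) + M + 1)\<^sup>2 \<le> ((M + 2) * R)\<^sup>2"
        using M_ge_4 by (intro power_mono) auto
      moreover have "1 \<le> ((M + 2) * R)\<^sup>2"
        using mult_mono[of 1 "M + 2" 1 R] R M_ge_4 by (intro one_le_power) simp
      ultimately have "1 + real (graph_dist c i x0) \<le> A * R\<^sup>2"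
        using graph_dist_le_square[of i x0] by (simp add: A_def power_mult_distrib)
      then have "(1 + real (graph_dist c i x0)) powr k \<le> (A * R\<^sup>2) powr k"
        using k by (intro powr_mono2) auto
      also have "\<dots> = A powr k * R powr (2 * k)"
        using A R by (simp add: powr_mult powr_powr flip: powr_numeral)
      finally have "\<bar>u i\<bar> \<le> C * (A powr k * R powr (2 * k))"
        using C[of i] \<open>C \<ge> 0\<close> by (meson mult_left_mono order_trans)
      then have "\<bar>u i\<bar>\<^sup>2 \<le> (C * (A powr k * R powr (2 * k)))\<^sup>2" by (intro power_mono) auto
      also have "\<dots> = (C * A powr k)\<^sup>2 * (R powr (2 * k))\<^sup>2" by (simp add: power_mult_distrib)
      also have "(R powr (2 * k))\<^sup>2 = R powr (4 * k)"
        by (simp add: power2_eq_square flip: powr_add)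
      finally show ?thesis by (simp add: power2_eq_square)
    qed
    have cardB: "real (card ?B) \<le> 16 * R powr 2"
    proof -
      have "real (card ?B) \<le> 4 * (R - 0 + 1) * (0 + R + 1)"
        using packing(2)[OF penny order_refl, of R "c x0"] R by simp
      also have "\<dots> \<le> (4 * (2 * R)) * (2 * R)" using R by (intro mult_mono) auto
      also have "\<dots> = 16 * R powr 2" using R by (simp add: power2_eq_square)
      finally show ?thesis .
    qed
    have "inner_on ?B u u \<le> (\<Sum>i\<in>?B. (C * A powr k)\<^sup>2 * R powr (4 * k))"
      unfolding inner_on_def using each by (intro sum_mono)
    also have "\<dots> = real (card ?B) * ((C * A powr k)\<^sup>2 * R powr (4 * k))" by simp
    also have "\<dots> \<le> 16 * R powr 2 * ((C * A powr k)\<^sup>2 * R powr (4 * k))"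
      using cardB by (intro mult_right_mono) auto
    also have "\<dots> = 16 * (C * A powr k)\<^sup>2 * R powr (4 * k + 2)"
      by (simp add: powr_add algebra_simps)
    also have "\<dots> \<le> K * R powr (4 * k + 2)" unfolding K_def by (intro mult_right_mono) auto
    finally show ?thesis by simp
  qed
  moreover have "K > 0" unfolding K_def by (simp add: add_nonneg_pos)
  ultimately show ?thesis by blast
qed

text \<open>
  The factor \<open>exp 6\<close> bounds \<open>(1 + 1/k)\<close> to the power \<open>4 * k + 2\<close>; the other factor, times \<open>k\<close>, bounds the traces.
\<close>

definition dimension_constant :: real where
  "dimension_constant = exp 6 * (125832 * T\<^sup>2 * 96)"

text \<open>
  The scales are the radii \<open>r j\<close>, each larger than the previous one by the factor \<open>1 + 1/k\<close>.
\<close>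

lemma independent_sequence_length_le:
  fixes u :: "nat \<Rightarrow> nat \<Rightarrow> real"
  assumes k: "k \<ge> 1"
    and mem: "\<And>n. n < m \<Longrightarrow> u n \<in> polynomial_growth_harmonic c x0 k"
    and indep: "\<And>n. n < m \<Longrightarrow> u n \<notin> real_fun_span (u ` {..<n})"
  shows "real m \<le> dimension_constant * k"
proof -
  define \<beta> where "\<beta> = 1 + 1 / k"
  \<comment> \<open>so large that consecutive radii differ by at least \<open>7 * T\<close>, as the mean value inequality requires\<close>
  define R0 where "R0 = 7 * T * k"
  define r where "r j = R0 * \<beta> ^ j" for j :: nat
  define S where "S j = {i. dist (c i) (c x0) \<le> r j}" for j
  define \<Lambda> where "\<Lambda> = \<beta> powr (4 * k + 2)"
  have \<beta>: "\<beta> > 1" using k by (simp add: \<beta>_def)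
  have "7 * T * 1 \<le> R0" unfolding R0_def using k T_ge_9 by (intro mult_left_mono) auto
  then have R0: "R0 \<ge> 1" using T_ge_9 by linarith
  have r_ge: "r j \<ge> R0" for j
    using mult_left_mono[OF one_le_power[of \<beta> j], of R0] \<beta> R0 by (simp add: r_def)
  have r_Suc: "r (Suc j) = r j + r j / k" for j
    by (simp add: r_def \<beta>_def algebra_simps)
  have gap: "r j / k \<ge> 7 * T" for j
    using r_ge[of j] k by (simp add: R0_def le_divide_eq)
  have "real m \<le> \<Lambda> * (125832 * T\<^sup>2 * (96 * k))"
  proof (rule dimension_bound_from_traces[of S m u])
    show "finite (S j)" for j unfolding S_def by (rule finite_in_cball[OF penny])
    show "S j \<subseteq> S (Suc j)" for j
      using gap[of j] T_ge_9 unfolding S_def r_Suc by auto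
    show "\<exists>j. i \<in> S j" for i
    proof -
      obtain j where "dist (c i) (c x0) < \<beta> ^ j" using real_arch_pow[OF \<beta>] by blast
      also have "\<beta> ^ j \<le> r j" using mult_right_mono[OF R0, of "\<beta> ^ j"] \<beta> by (simp add: r_def)
      finally have "i \<in> S j" by (simp add: S_def)
      then show ?thesis by (rule exI)
    qed
    show "u n \<notin> real_fun_span (u ` {..<n})" if "n < m" for n using indep[OF that] .
    show "\<Lambda> > 0" using \<beta> by (simp add: \<Lambda>_def)
    show "\<exists>K>0. \<forall>j. inner_on (S j) (u n) (u n) \<le> K * \<Lambda> ^ j" if n: "n < m" for n
    proof -
      obtain K where K: "K > 0"
        "\<And>R. R \<ge> 1 \<Longrightarrow> inner_on {i. dist (c i) (c x0) \<le> R} (u n) (u n) \<le> K * R powr (4 * k + 2)"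
        using l2_growth[OF mem[OF n] k] by blast
      have "inner_on (S j) (u n) (u n) \<le> K * R0 powr (4 * k + 2) * \<Lambda> ^ j" for j
      proof -
        have "(\<beta> ^ j) powr (4 * k + 2) = \<Lambda> ^ j"
          using \<beta> by (simp add: \<Lambda>_def powr_powr powr_power mult.commute flip: powr_realpow)
        then have "r j powr (4 * k + 2) = R0 powr (4 * k + 2) * \<Lambda> ^ j"
          using R0 \<beta> by (simp add: r_def powr_mult)
        moreover have "r j \<ge> 1" using r_ge[of j] R0 by linarith
        ultimately show ?thesis using K(2)[of "r j"] by (simp add: S_def mult.assoc)
      qed
      moreover have "K * R0 powr (4 * k + 2) > 0" using K(1) R0 by simp
      ultimately show ?thesis by blast
    qed
    show "(\<Sum>n<m. inner_on (S j) (e n) (e n)) \<le> 125832 * T\<^sup>2 * (96 * k)"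
      if e: "\<And>n. n < m \<Longrightarrow> e n \<in> real_fun_span (u ` {..<m})"
        and orth: "\<And>a b. a < m \<Longrightarrow> b < m \<Longrightarrow> inner_on (S (Suc j)) (e a) (e b) = (if a = b then 1 else 0)"
      for j e
    proof -
      have "real_fun_span (u ` {..<m}) \<subseteq> polynomial_growth_harmonic c x0 k"
        using mem by (intro real_fun.span_minimal subspace_polynomial_growth_harmonic) auto
      then have harm: "harmonic (e n)" if "n < m" for n
        using e[OF that] by (auto simp: polynomial_growth_harmonic_def)
      have "(\<Sum>n<m. inner_on (S j) (e n) (e n)) \<le> 125832 * T\<^sup>2 * (48 * (r j + r j / k) / (r j / k))"
        unfolding S_def
      proof (rule trace_le[OF harm])
        show "inner_on {i. dist (c i) (c x0) \<le> r j + r j / k} (e a) (e b) = (if a = b then 1 else 0)"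
          if "a < m" "b < m" for a b
          using orth[OF that] by (simp add: S_def r_Suc)
      qed (use gap r_ge[of j] R0 in auto)
      also have "48 * (r j + r j / k) / (r j / k) = 48 * (k + 1)"
        using k r_ge[of j] R0 by (simp add: field_simps)
      also have "125832 * T\<^sup>2 * (48 * (k + 1)) \<le> 125832 * T\<^sup>2 * (96 * k)"
        using k by (intro mult_left_mono) auto
      finally show ?thesis .
    qed
  qed
  also have "\<dots> \<le> exp 6 * (125832 * T\<^sup>2 * (96 * k))"
  proof (rule mult_right_mono)
    have "(4 * k + 2) * ln \<beta> \<le> (4 * k + 2) * (1 / k)"
      using k ln_add_one_self_le_self[of "1 / k"] unfolding \<beta>_def by (intro mult_left_mono) auto
    also have "\<dots> \<le> 6" using k by (simp add: field_simps)
    finally show "\<Lambda> \<le> exp 6" using \<beta> by (simp add: \<Lambda>_def powr_def)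
  qed (use k in auto)
  finally show ?thesis by (simp add: dimension_constant_def)
qed

lemma card_independent_le:
  assumes "k \<ge> 1" "B \<subseteq> polynomial_growth_harmonic c x0 k" "finite B" "\<not> real_fun.dependent B"
  shows "real (card B) \<le> dimension_constant * k"
proof -
  obtain us where us: "set us = B" "distinct us" using finite_distinct_list[OF assms(3)] by blast
  have "real (length us) \<le> dimension_constant * k"
  proof (rule independent_sequence_length_le[OF assms(1)])
    show "us ! n \<in> polynomial_growth_harmonic c x0 k" if "n < length us" for n
      using that us assms(2) by auto
    show "us ! n \<notin> real_fun_span ((!) us ` {..<n})" if n: "n < length us" for n
    proof
      assume *: "us ! n \<in> real_fun_span ((!) us ` {..<n})"
      have "(!) us ` {..<n} \<subseteq> B - {us ! n}"
        using n us by (auto simp: nth_eq_iff_index_eq)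
      then have "us ! n \<in> real_fun_span (B - {us ! n})" using * real_fun.span_mono by blast
      moreover have "us ! n \<in> B" using n us by auto
      ultimately show False using assms(4) unfolding real_fun.dependent_def by blast
    qed
  qed
  then show ?thesis using us distinct_card by fastforce
qed

theorem dimension_polynomial_growth_harmonic:
  assumes "k \<ge> 1"
  shows "finite_dimensional (polynomial_growth_harmonic c x0 k)"
    and "real (real_fun_dim (polynomial_growth_harmonic c x0 k)) \<le> dimension_constant * k"
proof -
  let ?H = "polynomial_growth_harmonic c x0 k"
  obtain B where B: "B \<subseteq> ?H" "\<not> real_fun.dependent B" "?H \<subseteq> real_fun_span B" "card B = real_fun_dim ?H"
    using real_fun.basis_exists by blast
  have "finite B"
  proof (rule ccontr)
    assume inf: "infinite B"
    define n where "n = nat \<lceil>dimension_constant * k\<rceil> + 1"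
    obtain A where A: "A \<subseteq> B" "finite A" "card A = n" using infinite_arbitrarily_large[OF inf] by metis
    have "\<not> real_fun.dependent A" using B(2) A(1) real_fun.dependent_mono by blast
    then have "real n \<le> dimension_constant * k"
      using card_independent_le[OF assms, of A x0] A B(1) by auto
    then show False unfolding n_def by linarith
  qed
  then show "finite_dimensional ?H" using B(3) unfolding finite_dimensional_def by blast
  show "real (real_fun_dim ?H) \<le> dimension_constant * k"
    using card_independent_le[OF assms B(1) \<open>finite B\<close> B(2)] B(4) by simp
qed

end

theorem theorem1p2:
  shows "\<forall>D :: nat. \<exists>C :: real. \<forall>c :: nat \<Rightarrow> real ^ 2.
    penny_configuration c \<and> graph_connected c \<and>
    (SUP \<sigma>\<in>faces c. facial_degree c \<sigma>) = enat D \<longrightarrow>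
      (\<forall>x0. \<forall>k :: real. k \<ge> 1 \<longrightarrow>
         finite_dimensional (polynomial_growth_harmonic c x0 k) \<and>
         real (real_fun_dim (polynomial_growth_harmonic c x0 k)) \<le> C * k)"
proof
  fix D :: nat
  show "\<exists>C :: real. \<forall>c :: nat \<Rightarrow> real ^ 2.
    penny_configuration c \<and> graph_connected c \<and>
    (SUP \<sigma>\<in>faces c. facial_degree c \<sigma>) = enat D \<longrightarrow>
      (\<forall>x0. \<forall>k :: real. k \<ge> 1 \<longrightarrow>
         finite_dimensional (polynomial_growth_harmonic c x0 k) \<and>
         real (real_fun_dim (polynomial_growth_harmonic c x0 k)) \<le> C * k)"
  proof (intro exI[of _ "bounded_penny_graph.dimension_constant D"] allI impI)
    fix c x0 and k :: real
    assume *: "penny_configuration c \<and> graph_connected c \<and> (SUP \<sigma>\<in>faces c. facial_degree c \<sigma>) = enat D"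
      and k: "k \<ge> 1"
    interpret bounded_penny_graph c D
    proof
      show "facial_degree c \<sigma> \<le> enat D" if "\<sigma> \<in> faces c" for \<sigma>
        using * SUP_upper[OF that, of "facial_degree c"] by simp
    qed (use * in auto)
    show "finite_dimensional (polynomial_growth_harmonic c x0 k) \<and>
         real (real_fun_dim (polynomial_growth_harmonic c x0 k)) \<le> dimension_constant * k"
      using dimension_polynomial_growth_harmonic[OF k] by blast
  qed
qed

end
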